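(* Let $\alpha\ge 0$ and, for $N\in\mathbb{N}$, let $$n(\alpha,N):=\tfrac12-\alpha+\tfrac12\sqrt{(2\alpha+1)(2\alpha+2N+1)}.$$ For each $u\in \mathcal{C}[-1,1]\cap\mathcal{BV}[-1,1]$ there is a constant $C>0$ (depending only on $\alpha$ and $u$) such that for all $N\in\mathbb{N}$, all integers $n\ge 1$ with $n\le n(\alpha,N)$, and each $x\in[-1,1]$, $$\left|u(x)-\sum_{k=0}^n \frac{\langle u,Q_k\rangle_\omega}{\langle Q_k,Q_k\rangle_\omega}\,Q_k\!\left(\tfrac N2(1+x)\right)\right|\le \left|u(x)-\sum_{k=0}^n \frac{(u,P_k)_\varrho}{(P_k,P_k)_\varrho}\,P_k(x)\right|+C\,\frac{n^{3+\alpha+\max\{1,\alpha\}}}{N}.$$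
   Context: $\mathcal{BV}[-1,1]$ is the set of real functions on $[-1,1]$ of finite total variation. Binomial coefficients with real entries are defined via the Gamma function. $P_k=P_k^{\alpha,\alpha}$ is the Jacobi polynomial of degree $k$ with both parameters equal to $\alpha$, normalized by $P_k(1)=\binom{k+\alpha}{k}$. It is orthogonal with respect to $(f,g)_\varrho=\int_{-1}^1 f(x)g(x)\varrho(x)\,dx$, $\varrho(x)=(1-x)^\alpha(1+x)^\alpha$. $Q_k=Q_k(\cdot;\alpha,\alpha,N)$ is the Hahn polynomial of degree $k$ ($0\le k\le N$), where $Q_k(y;\alpha,\beta,N)=\sum_{j=0}^k\frac{(-k)_j(k+\alpha+\beta+1)_j(-y)_j}{(\alpha+1)_j(-N)_j\,j!}$ and $(a)_j=a(a+1)\cdots(a+j-1)$. These are orthogonal with respect to $\langle f,g\rangle_\omega=\sum_{i=0}^N f(i)g(i)\omega(i)$, $\omega(i)=\binom{\alpha+i}{i}\binom{\alpha+N-i}{N-i}$. A function $u$ on $[-1,1]$ appearing in $\langle\cdot,\cdot\rangle_\omega$ is identified with $i\mapsto u(2i/N-1)$, so $\langle u,Q_k\rangle_\omega=\sum_{i=0}^N u(2i/N-1)Q_k(i)\omega(i)$. *)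

theory Defs
  imports "HOL-Analysis.Analysis"
begin

definition bounded_variation_on :: "real \<Rightarrow> real \<Rightarrow> (real \<Rightarrow> real) \<Rightarrow> bool" where
  "bounded_variation_on a b u \<longleftrightarrow>
     bdd_above {(\<Sum>i<m. \<bar>u (t (Suc i)) - u (t i)\<bar>) |m t.
       mono_on {..m} (t :: nat \<Rightarrow> real) \<and> t ` {..m} \<subseteq> {a..b}}"

definition rbinom :: "real \<Rightarrow> real \<Rightarrow> real" where
  "rbinom x y = Gamma (x + 1) / (Gamma (y + 1) * Gamma (x - y + 1))"

lemma rbinom_eq_gchoose:
  assumes "x + 1 \<notin> \<int>\<^sub>\<le>\<^sub>0"
  shows "rbinom x (real k) = x gchoose k"
  using gbinomial_Gamma[OF assms, of k] Gamma_fact[of k, where ?'a = real]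
  by (simp add: rbinom_def add_ac)

text \<open>
  The Jacobi polynomial of degree \<open>k\<close>, as the hypergeometric sum
  \<open>binom(k + \<alpha>, k) 2F1(-k, k + \<alpha> + \<beta> + 1; \<alpha> + 1; (1 - x)/2)\<close>.  This is its standard explicit
  form, and the leading factor is the normalisation at \<open>x = 1\<close>.
\<close>

definition jacobi_P :: "real \<Rightarrow> real \<Rightarrow> nat \<Rightarrow> real \<Rightarrow> real" where
  "jacobi_P \<alpha> \<beta> k x = rbinom (real k + \<alpha>) (real k) *
     (\<Sum>j\<le>k. pochhammer (- real k) j * pochhammer (real k + \<alpha> + \<beta> + 1) j /
             (pochhammer (\<alpha> + 1) j * fact j) * ((1 - x) / 2) ^ j)"

lemma jacobi_P_1: "jacobi_P \<alpha> \<beta> k 1 = rbinom (real k + \<alpha>) (real k)"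
  by (simp add: jacobi_P_def power_0_left if_distrib cong: if_cong)

text \<open>
  For \<open>\<alpha> = 0\<close> the factors vanish at the endpoints (\<open>0 powr 0 = 0\<close>) instead of being \<open>1\<close>;
  this changes the weight only on a null set.
\<close>

definition jacobi_weight :: "real \<Rightarrow> real \<Rightarrow> real" where
  "jacobi_weight \<alpha> x = (1 - x) powr \<alpha> * (1 + x) powr \<alpha>"

definition jacobi_inner :: "real \<Rightarrow> (real \<Rightarrow> real) \<Rightarrow> (real \<Rightarrow> real) \<Rightarrow> real" where
  "jacobi_inner \<alpha> f g = integral {-1..1} (\<lambda>x. f x * g x * jacobi_weight \<alpha> x)"

text \<open>The argument \<open>y\<close> is real, since the polynomial is evaluated off the grid as well.\<close>

definition hahn_Q :: "real \<Rightarrow> real \<Rightarrow> nat \<Rightarrow> nat \<Rightarrow> real \<Rightarrow> real" where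
  "hahn_Q \<alpha> \<beta> N k y =
     (\<Sum>j\<le>k. pochhammer (- real k) j * pochhammer (real k + \<alpha> + \<beta> + 1) j * pochhammer (- y) j /
             (pochhammer (\<alpha> + 1) j * pochhammer (- real N) j * fact j))"

definition hahn_weight :: "real \<Rightarrow> nat \<Rightarrow> nat \<Rightarrow> real" where
  "hahn_weight \<alpha> N i =
     rbinom (\<alpha> + real i) (real i) * rbinom (\<alpha> + real N - real i) (real N - real i)"

definition hahn_inner :: "real \<Rightarrow> nat \<Rightarrow> (real \<Rightarrow> real) \<Rightarrow> (real \<Rightarrow> real) \<Rightarrow> real" where
  "hahn_inner \<alpha> N f g = (\<Sum>i\<le>N. f (real i) * g (real i) * hahn_weight \<alpha> N i)"

definition on_grid :: "nat \<Rightarrow> (real \<Rightarrow> real) \<Rightarrow> real \<Rightarrow> real" where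
  "on_grid N u y = u (2 * y / real N - 1)"

definition jacobi_partial_sum :: "real \<Rightarrow> nat \<Rightarrow> (real \<Rightarrow> real) \<Rightarrow> real \<Rightarrow> real" where
  "jacobi_partial_sum \<alpha> n u x =
     (\<Sum>k\<le>n. jacobi_inner \<alpha> u (jacobi_P \<alpha> \<alpha> k) /
              jacobi_inner \<alpha> (jacobi_P \<alpha> \<alpha> k) (jacobi_P \<alpha> \<alpha> k) * jacobi_P \<alpha> \<alpha> k x)"

definition hahn_partial_sum :: "real \<Rightarrow> nat \<Rightarrow> nat \<Rightarrow> (real \<Rightarrow> real) \<Rightarrow> real \<Rightarrow> real" where
  "hahn_partial_sum \<alpha> N n u x =
     (\<Sum>k\<le>n. hahn_inner \<alpha> N (on_grid N u) (hahn_Q \<alpha> \<alpha> N k) /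
              hahn_inner \<alpha> N (hahn_Q \<alpha> \<alpha> N k) (hahn_Q \<alpha> \<alpha> N k) *
              hahn_Q \<alpha> \<alpha> N k (real N / 2 * (1 + x)))"

definition n_bound :: "real \<Rightarrow> nat \<Rightarrow> real" where
  "n_bound \<alpha> N = 1/2 - \<alpha> + 1/2 * sqrt ((2 * \<alpha> + 1) * (2 * \<alpha> + 2 * real N + 1))"

end

theory Submission
  imports Defs "HOL-Computational_Algebra.Polynomial"
begin

text \<open>
  Put \<open>x = 2 t - 1\<close> with \<open>0 \<le> t \<le> 1\<close>, let \<open>w(t) = t^\<alpha> (1 - t)^\<alpha>\<close>, and let \<open>R\<^sub>k\<close> be the Jacobi
  polynomial in \<open>t\<close> with \<open>R\<^sub>k(0) = 1\<close>.  The proof rests on the Bernstein operator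
  \<open>(B f)(t) = (\<Sum>i\<le>N. f(i/N) b\<^sub>i(t))\<close>, which ties the two orthogonal systems together:

  \<^item> The weight \<open>\<omega>(i)\<close> is a fixed multiple of \<open>\<integral> b\<^sub>i w\<close>: it is the beta-binomial distribution.
  \<^item> \<open>B Q\<^sub>k = R\<^sub>k\<close>, with \<open>Q\<^sub>k\<close> read as a function of \<open>i/N\<close>, because \<open>B\<close> sends a normalised falling factorial to a power
    (\<open>Bernstein_hahn_Q\<close>).
  \<^item> \<open>\<mu>\<^sub>k Q\<^sub>k(y)\<close> is the expectation of \<open>R\<^sub>k(S)\<close> for a Beta distributed \<open>S\<close> with parameters
    \<open>y + \<alpha> + 1\<close> and \<open>N - y + \<alpha> + 1\<close> (\<open>has_integral_jac_beta_kernel\<close>).  At grid points this map is the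
    adjoint of \<open>B\<close>, and \<open>\<mu>\<^sub>k\<close> is an eigenvalue of the Bernstein-Durrmeyer operator.

  Consequently the Hahn coefficient of \<open>u\<close> is exactly the Jacobi coefficient \<open>c\<^sub>k(B u)\<close> of \<open>B u\<close>
  (\<open>hahn_partial_sum_eq\<close>).  The two partial sums therefore differ by
  \<open>(\<Sum>k\<le>n. (c\<^sub>k(B u) - c\<^sub>k(u)) R\<^sub>k + c\<^sub>k(B u) (Q\<^sub>k - R\<^sub>k))\<close>, and \<open>\<bar>R\<^sub>k\<bar> \<le> 1\<close>.

  Both differences come down to one estimate: a Beta distributed variable has variance of order
  \<open>1/N\<close>, so replacing it by its mean costs \<open>O(M/N)\<close> as soon as \<open>t (1 - t) \<bar>F''(t)\<bar> \<le> M\<close>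
  (\<open>beta_expectation_bound\<close>).  The factor \<open>t (1 - t)\<close> is what makes this work up to the endpoints.
  With \<open>F = R\<^sub>k\<close> the differential equation gives \<open>M = O(k\<^sup>2)\<close>, hence \<open>Q\<^sub>k - R\<^sub>k = O(k\<^sup>2/N)\<close>; here the
  hypothesis \<open>n \<le> n(\<alpha>,N)\<close> enters, since it says that \<open>k\<^sup>2 = O(N)\<close> and so keeps \<open>\<mu>\<^sub>k\<close> away from \<open>0\<close>.
  For the coefficients, summation by parts turns \<open>\<integral> (B u - u) R\<^sub>k w\<close> into a sum of increments of \<open>u\<close>
  against Beta expectations of an antiderivative of \<open>R\<^sub>k w\<close>; bounded variation and the inequality
  \<open>sqrt (t (1 - t)) \<bar>R\<^sub>k'\<bar> = O(k)\<close> then give \<open>O(k/N)\<close> (\<open>bernstein_functional_error\<close>).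
  Since \<open>1 / \<parallel>R\<^sub>k\<parallel>\<^sup>2 = O(k^(2 \<alpha> + 1))\<close>, the \<open>k\<close>-th term is
  \<open>O((k^(2 \<alpha> + 2) + k^(\<alpha> + 5/2)) / N)\<close>, and summing over \<open>k \<le> n\<close> gives the claim.
\<close>

section \<open>Terminating hypergeometric sums\<close>

text \<open>
  The sum \<open>2F1(-n, b; c; 1)\<close>.  It is the binomial theorem for rising factorials, applied to
  \<open>b + (1 - c - n)\<close>, with the second factor reversed.
\<close>

lemma chu_vandermonde:
  fixes b c :: real
  assumes "pochhammer c n \<noteq> 0"
  shows "(\<Sum>j\<le>n. pochhammer (- real n) j * pochhammer b j / (pochhammer c j * fact j))
         = pochhammer (c - b) n / pochhammer c n"
proof -
  have "pochhammer (c - b) n = (-1) ^ n * pochhammer (b + (1 - c - real n)) n"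
    using pochhammer_minus[of "b - c" n] by (simp add: algebra_simps)
  also have "\<dots> = (\<Sum>j\<le>n. (-1) ^ n * (real (n choose j) * pochhammer b j *
                               pochhammer (1 - c - real n) (n - j)))"
    by (simp add: pochhammer_binomial_sum sum_distrib_left)
  also have "\<dots> = (\<Sum>j\<le>n. pochhammer c n *
      (pochhammer (- real n) j * pochhammer b j / (pochhammer c j * fact j)))"
  proof (intro sum.cong refl)
    fix j assume "j \<in> {..n}"
    then have j: "j \<le> n" by simp
    have nz: "pochhammer c j \<noteq> 0"
      using assms j pochhammer_neq_0_mono by blast
    have split: "pochhammer c n = pochhammer c j * pochhammer (c + real j) (n - j)"
      using j by (rule pochhammer_product)
    have rev: "pochhammer (1 - c - real n) (n - j) = (-1) ^ (n - j) * pochhammer (c + real j) (n - j)"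
      using pochhammer_minus[of "c + real n - 1" "n - j"] j by (simp add: algebra_simps of_nat_diff)
    have ch: "pochhammer (- real n) j = (-1) ^ j * (fact j * real (n choose j))"
      by (simp add: pochhammer_minus binomial_gbinomial gbinomial_pochhammer')
    have sgn: "(-1::real) ^ n * (-1) ^ (n - j) = (-1) ^ j"
      using j by (auto simp: minus_one_power_iff)
    have "(-1) ^ n * (real (n choose j) * pochhammer b j * pochhammer (1 - c - real n) (n - j))
          = ((-1) ^ n * (-1) ^ (n - j)) * (real (n choose j) * pochhammer b j * pochhammer (c + real j) (n - j))"
      by (simp add: rev)
    also have "\<dots> = pochhammer c n *
      (pochhammer (- real n) j * pochhammer b j / (pochhammer c j * fact j))"
      unfolding sgn using nz by (simp add: split ch)
    finally show "(-1) ^ n * (real (n choose j) * pochhammer b j * pochhammer (1 - c - real n) (n - j)) = \<dots>" .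
  qed
  also have "\<dots> = pochhammer c n *
      (\<Sum>j\<le>n. pochhammer (- real n) j * pochhammer b j / (pochhammer c j * fact j))"
    by (simp only: sum_distrib_left)
  finally show ?thesis
    using assms by (simp add: nonzero_eq_divide_eq mult.commute)
qed

text \<open>
  Weighting by \<open>j choose i\<close> only removes the first \<open>i\<close> terms and shifts all parameters by \<open>i\<close>.  In this
  form the sum evaluates the inner sum after a double hypergeometric sum has been interchanged.
\<close>

lemma chu_vandermonde_binomial:
  fixes a f :: real
  assumes f: "pochhammer f k \<noteq> 0" and i: "i \<le> k"
  shows "(\<Sum>j\<le>k. pochhammer (- real k) j * pochhammer a j / (pochhammer f j * fact j) * real (j choose i))
         = pochhammer (- real k) i * pochhammer a i * pochhammer (f - a) (k - i)
           / (pochhammer f k * fact i)"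
    (is "(\<Sum>j\<le>k. ?c j * _) = _")
proof -
  define d where "d = pochhammer (- real k) i * pochhammer a i / (pochhammer f i * fact i)"
  have gen: "(A * B) * (C * D) / ((E * F) * G) * (G / (H * I)) = (A * C / (E * H)) * (B * D / (F * I))"
    if "G \<noteq> 0" for A B C D E F G H I :: real
    using that by (simp add: mult_ac)
  have fk: "pochhammer f k = pochhammer f i * pochhammer (f + real i) (k - i)"
    using i by (rule pochhammer_product)
  have "(\<Sum>j\<le>k. ?c j * real (j choose i)) = (\<Sum>j=i..k. ?c j * real (j choose i))"
    by (intro sum.mono_neutral_right) (auto simp: binomial_eq_0)
  also have "\<dots> = (\<Sum>m\<le>k-i. ?c (m + i) * real ((m + i) choose i))"
    using i by (intro sum.reindex_bij_witness[of _ "\<lambda>m. m + i" "\<lambda>j. j - i"]) auto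
  also have "\<dots> = (\<Sum>m\<le>k-i. d * (pochhammer (- real (k - i)) m * pochhammer (a + real i) m
                     / (pochhammer (f + real i) m * fact m)))"
  proof (intro sum.cong refl)
    fix m assume "m \<in> {..k-i}"
    have c: "real ((m + i) choose i) = fact (m + i) / (fact i * fact m)"
      by (subst binomial_fact) auto
    have e: "- real k + real i = - real (k - i)" using i by (simp add: of_nat_diff)
    have p: "pochhammer (- real k) (m + i) = pochhammer (- real k) i * pochhammer (- real (k - i)) m"
      "pochhammer a (m + i) = pochhammer a i * pochhammer (a + real i) m"
      "pochhammer f (m + i) = pochhammer f i * pochhammer (f + real i) m"
      unfolding e [symmetric] add.commute[of m i] by (rule pochhammer_product')+
    show "?c (m + i) * real ((m + i) choose i) = d * (pochhammer (- real (k - i)) m * pochhammer (a + real i) m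
                     / (pochhammer (f + real i) m * fact m))"
      unfolding c p d_def by (rule gen) simp
  qed
  also have "\<dots> = d * (pochhammer (f - a) (k - i) / pochhammer (f + real i) (k - i))"
    using chu_vandermonde[of "f + real i" "k - i" "a + real i"] f fk
    by (simp only: sum_distrib_left[symmetric]) auto
  finally show ?thesis by (simp add: d_def fk)
qed

section \<open>Jacobi and Hahn polynomials\<close>

definition jcoeff :: "real \<Rightarrow> nat \<Rightarrow> nat \<Rightarrow> real" where
  "jcoeff \<alpha> k j = pochhammer (- real k) j * pochhammer (real k + 2 * \<alpha> + 1) j
                   / (pochhammer (\<alpha> + 1) j * fact j)"

text \<open>
  The Jacobi polynomial with both parameters \<open>\<alpha>\<close>, in the variable \<open>t = (1 - x) / 2\<close> and with value \<open>1\<close> at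
  \<open>t = 0\<close>.  As a formal polynomial it has \<open>pderiv\<close> available, and its differential equation can be read
  off from the coefficients.
\<close>

definition jac :: "real \<Rightarrow> nat \<Rightarrow> real poly" where
  "jac \<alpha> k = (\<Sum>j\<le>k. monom (jcoeff \<alpha> k j) j)"

lemma poly_jac: "poly (jac \<alpha> k) t = (\<Sum>j\<le>k. jcoeff \<alpha> k j * t ^ j)"
  by (simp add: jac_def poly_sum poly_monom)

lemma coeff_jac: "coeff (jac \<alpha> k) j = jcoeff \<alpha> k j"
proof -
  have "jcoeff \<alpha> k j = 0" if "j > k"
    using that by (simp add: jcoeff_def pochhammer_of_nat_eq_0_lemma)
  then show ?thesis
    by (auto simp: jac_def coeff_sum not_le)
qed

lemma poly_jac_0 [simp]: "poly (jac \<alpha> k) 0 = 1"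
  by (simp add: poly_0_coeff_0 coeff_jac jcoeff_def)

lemma jac_0 [simp]: "jac \<alpha> 0 = 1"
  by (simp add: jac_def jcoeff_def)

text \<open>
  Hahn polynomials are normalised at the left end of the grid and Jacobi polynomials at \<open>x = 1\<close>, so
  comparing them needs this symmetry.
\<close>

lemma poly_jac_reflect:
  assumes "\<alpha> \<ge> 0"
  shows "poly (jac \<alpha> k) (1 - t) = (-1) ^ k * poly (jac \<alpha> k) t"
proof -
  have nz: "pochhammer (\<alpha> + 1) k > 0" for k
    using assms by (intro pochhammer_pos) auto
  have "poly (jac \<alpha> k) (1 - t) = (\<Sum>j\<le>k. \<Sum>i\<le>k. jcoeff \<alpha> k j * real (j choose i) * (- t) ^ i)"
    unfolding poly_jac
  proof (intro sum.cong refl)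
    fix j assume j: "j \<in> {..k}"
    have "(1 - t) ^ j = (\<Sum>i\<le>j. real (j choose i) * (- t) ^ i)"
      using binomial_ring[of "-t" 1 j] by simp
    also have "\<dots> = (\<Sum>i\<le>k. real (j choose i) * (- t) ^ i)"
      using j by (intro sum.mono_neutral_left) (auto simp: binomial_eq_0)
    finally show "jcoeff \<alpha> k j * (1 - t) ^ j = (\<Sum>i\<le>k. jcoeff \<alpha> k j * real (j choose i) * (- t) ^ i)"
      by (simp add: sum_distrib_left mult.assoc)
  qed
  also have "\<dots> = (\<Sum>i\<le>k. (\<Sum>j\<le>k. jcoeff \<alpha> k j * real (j choose i)) * (- t) ^ i)"
    by (subst sum.swap) (simp add: sum_distrib_right)
  also have "\<dots> = (\<Sum>i\<le>k. (-1) ^ k * (jcoeff \<alpha> k i * t ^ i))"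
  proof (intro sum.cong refl)
    fix i assume "i \<in> {..k}"
    then have i: "i \<le> k" by simp
    have "pochhammer (\<alpha> + 1 - (real k + 2 * \<alpha> + 1)) (k - i)
        = (-1) ^ (k - i) * pochhammer (\<alpha> + 1 + real i) (k - i)"
      using pochhammer_minus[of "real k + \<alpha>" "k - i"] i by (simp add: of_nat_diff add_ac)
    moreover have "pochhammer (\<alpha> + 1) k = pochhammer (\<alpha> + 1) i * pochhammer (\<alpha> + 1 + real i) (k - i)"
      using i by (rule pochhammer_product)
    moreover have "pochhammer (\<alpha> + 1) i \<noteq> 0" "pochhammer (\<alpha> + 1 + real i) (k - i) \<noteq> 0"
      using nz[of k] calculation(2) by auto
    ultimately have eq: "(\<Sum>j\<le>k. jcoeff \<alpha> k j * real (j choose i)) = jcoeff \<alpha> k i * (-1) ^ (k - i)"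
      using chu_vandermonde_binomial[of "\<alpha> + 1" k i "real k + 2 * \<alpha> + 1"] i nz[of k]
      by (auto simp: jcoeff_def mult_ac)
    have sgn: "(-1::real) ^ (k - i) * (-t) ^ i = (-1) ^ k * t ^ i"
      using i by (cases "even i"; cases "even k") (auto simp: minus_one_power_iff)
    show "(\<Sum>j\<le>k. jcoeff \<alpha> k j * real (j choose i)) * (- t) ^ i = (-1) ^ k * (jcoeff \<alpha> k i * t ^ i)"
      unfolding eq mult.assoc sgn by simp
  qed
  finally show ?thesis by (simp add: poly_jac sum_distrib_left)
qed

text \<open>
  The eigenvalue of the Bernstein-Durrmeyer operator of degree \<open>N\<close> with Jacobi weight, belonging to the
  Jacobi polynomial of degree \<open>k\<close>.
\<close>

definition durrmeyer_eig :: "real \<Rightarrow> nat \<Rightarrow> nat \<Rightarrow> real" where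
  "durrmeyer_eig \<alpha> N k = pochhammer (real N + 1 - real k) k / pochhammer (real N + 2 * \<alpha> + 2) k"

text \<open>
  This is Sheppard's transformation of a terminating \<open>3F2\<close> series at \<open>1\<close>.  Its right-hand side is the
  Jacobi polynomial with \<open>t^j\<close> replaced by the \<open>j\<close>-th moment of a Beta distribution.
\<close>

lemma hahn_Q_transform:
  assumes "\<alpha> \<ge> 0" and k: "k \<le> N"
  shows "durrmeyer_eig \<alpha> N k * hahn_Q \<alpha> \<alpha> N k y
    = (\<Sum>j\<le>k. jcoeff \<alpha> k j * pochhammer (y + \<alpha> + 1) j / pochhammer (real N + 2 * \<alpha> + 2) j)"
proof -
  define f where "f = real N + 2 * \<alpha> + 2"
  define a where "a = real k + 2 * \<alpha> + 1"
  have nz: "pochhammer (\<alpha> + 1) j > 0" "pochhammer f j > 0" for j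
    using assms unfolding f_def by (auto intro!: pochhammer_pos)
  have "(\<Sum>j\<le>k. jcoeff \<alpha> k j * pochhammer (y + \<alpha> + 1) j / pochhammer f j)
     = (\<Sum>j\<le>k. \<Sum>i\<le>k. pochhammer (- real k) j * pochhammer a j / (pochhammer f j * fact j)
          * real (j choose i) * ((-1) ^ i * pochhammer (- y) i / pochhammer (\<alpha> + 1) i))"
  proof (intro sum.cong refl)
    fix j assume j: "j \<in> {..k}"
    \<comment> \<open>The moments are expanded in the basis \<open>pochhammer (- y) i\<close> of the Hahn series.\<close>
    have "pochhammer (y + \<alpha> + 1) j / pochhammer (\<alpha> + 1) j
      = (\<Sum>i\<le>j. pochhammer (- real j) i * pochhammer (- y) i / (pochhammer (\<alpha> + 1) i * fact i))"
      using chu_vandermonde[of "\<alpha> + 1" j "- y"] nz(1)[of j] by (simp add: algebra_simps)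
    also have "\<dots> = (\<Sum>i\<le>j. real (j choose i) * ((-1) ^ i * pochhammer (- y) i / pochhammer (\<alpha> + 1) i))"
    proof (intro sum.cong refl)
      fix i
      have "pochhammer (- real j) i = (-1) ^ i * (fact i * real (j choose i))"
        by (simp add: pochhammer_minus binomial_gbinomial gbinomial_pochhammer')
      then show "pochhammer (- real j) i * pochhammer (- y) i / (pochhammer (\<alpha> + 1) i * fact i)
         = real (j choose i) * ((-1) ^ i * pochhammer (- y) i / pochhammer (\<alpha> + 1) i)"
        by simp
    qed
    also have "\<dots> = (\<Sum>i\<le>k. real (j choose i) * ((-1) ^ i * pochhammer (- y) i / pochhammer (\<alpha> + 1) i))"
      using j by (intro sum.mono_neutral_left) (auto simp: binomial_eq_0)
    finally have "pochhammer (y + \<alpha> + 1) j / pochhammer (\<alpha> + 1) j = \<dots>" .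
    moreover have "jcoeff \<alpha> k j * pochhammer (y + \<alpha> + 1) j / pochhammer f j =
       pochhammer (- real k) j * pochhammer a j / (pochhammer f j * fact j) *
        (pochhammer (y + \<alpha> + 1) j / pochhammer (\<alpha> + 1) j)"
      by (simp add: jcoeff_def a_def)
    ultimately show "jcoeff \<alpha> k j * pochhammer (y + \<alpha> + 1) j / pochhammer f j =
      (\<Sum>i\<le>k. pochhammer (- real k) j * pochhammer a j / (pochhammer f j * fact j)
          * real (j choose i) * ((-1) ^ i * pochhammer (- y) i / pochhammer (\<alpha> + 1) i))"
      by (simp only: sum_distrib_left mult.assoc)
  qed
  also have "\<dots> = (\<Sum>i\<le>k. (\<Sum>j\<le>k. pochhammer (- real k) j * pochhammer a j / (pochhammer f j * fact j)
          * real (j choose i)) * ((-1) ^ i * pochhammer (- y) i / pochhammer (\<alpha> + 1) i))"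
    by (subst sum.swap) (simp only: sum_distrib_right)
  also have "\<dots> = (\<Sum>i\<le>k. durrmeyer_eig \<alpha> N k * (pochhammer (- real k) i * pochhammer a i * pochhammer (- y) i
       / (pochhammer (\<alpha> + 1) i * pochhammer (- real N) i * fact i)))"
  proof (intro sum.cong refl)
    fix i assume "i \<in> {..k}"
    then have i: "i \<le> k" by simp
    have fa: "f - a = real N + 1 - real k" by (simp add: f_def a_def)
    have sh: "real N + 1 - real k + real (k - i) = real N + 1 - real i"
      "real N - real i + 1 = real N + 1 - real i"
      using i by (simp_all add: of_nat_diff)
    define X where "X = pochhammer (real N + 1 - real k) (k - i)"
    define Z where "Z = pochhammer (real N + 1 - real i) i"
    define s where "s = (-1::real) ^ i"
    have XZ: "pochhammer (real N + 1 - real k) k = X * Z"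
      using pochhammer_product[of "k - i" k "real N + 1 - real k"] i unfolding sh X_def Z_def by simp
    have sZ: "pochhammer (- real N) i = s * Z"
      using pochhammer_minus[of "real N" i] unfolding sh s_def Z_def .
    have nz': "s * Z \<noteq> 0"
      using i k by (simp add: pochhammer_of_nat_eq_0_iff flip: sZ)
    have "X * s * (s * Z) = X * (s * s) * Z" by (simp only: mult.assoc)
    also have "s * s = 1" by (simp add: s_def flip: power_add)
    finally have "X * s = X * Z / (s * Z)" using nz' by (simp add: nonzero_eq_divide_eq)
    then have "pochhammer (f - a) (k - i) * (-1) ^ i
       = pochhammer (real N + 1 - real k) k / pochhammer (- real N) i"
      unfolding fa XZ sZ by (simp only: X_def s_def)
    then have *: "pochhammer (f - a) (k - i) * (-1) ^ i / pochhammer f k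
       = durrmeyer_eig \<alpha> N k / pochhammer (- real N) i"
      by (simp add: durrmeyer_eig_def f_def mult.commute)
    have "(\<Sum>j\<le>k. pochhammer (- real k) j * pochhammer a j / (pochhammer f j * fact j)
          * real (j choose i)) * ((-1) ^ i * pochhammer (- y) i / pochhammer (\<alpha> + 1) i)
       = (pochhammer (f - a) (k - i) * (-1) ^ i / pochhammer f k) *
          (pochhammer (- real k) i * pochhammer a i * pochhammer (- y) i
             / (pochhammer (\<alpha> + 1) i * fact i))"
      using chu_vandermonde_binomial[of f k i a] i nz(2)[of k] by (simp add: mult_ac)
    also have "\<dots> = durrmeyer_eig \<alpha> N k * (pochhammer (- real k) i * pochhammer a i * pochhammer (- y) i
       / (pochhammer (\<alpha> + 1) i * pochhammer (- real N) i * fact i))"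
      unfolding * by simp
    finally show "(\<Sum>j\<le>k. pochhammer (- real k) j * pochhammer a j / (pochhammer f j * fact j)
          * real (j choose i)) * ((-1) ^ i * pochhammer (- y) i / pochhammer (\<alpha> + 1) i) = \<dots>" .
  qed
  also have "\<dots> = durrmeyer_eig \<alpha> N k * hahn_Q \<alpha> \<alpha> N k y"
    unfolding hahn_Q_def sum_distrib_left
    by (simp only: a_def add.assoc mult_2 [symmetric])
  finally show ?thesis by (simp only: f_def)
qed

text \<open>
  The quotient is \<open>(i choose j) / (N choose j)\<close>, so cancelling binomials leaves \<open>t^j\<close> times the partition
  of unity of degree \<open>N - j\<close>.
\<close>

lemma sum_binomial_Bernstein:
  assumes "j \<le> N"
  shows "(\<Sum>i\<le>N. pochhammer (- real i) j / pochhammer (- real N) j * Bernstein N i t) = t ^ j"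
proof -
  have p: "pochhammer (- real i) j = (-1) ^ j * (fact j * real (i choose j))" for i
    by (simp add: pochhammer_minus binomial_gbinomial gbinomial_pochhammer')
  have "(\<Sum>i\<le>N. pochhammer (- real i) j / pochhammer (- real N) j * Bernstein N i t)
      = (\<Sum>i\<le>N. real (i choose j) / real (N choose j) * Bernstein N i t)"
    unfolding p by simp
  also have "\<dots> = (\<Sum>i=j..N. real (i choose j) / real (N choose j) * Bernstein N i t)"
    by (intro sum.mono_neutral_right) (auto simp: binomial_eq_0)
  also have "\<dots> = (\<Sum>m\<le>N-j. t ^ j * Bernstein (N - j) m t)"
  proof (rule sum.reindex_bij_witness[of _ "\<lambda>m. m + j" "\<lambda>i. i - j"])
    fix i assume i: "i \<in> {j..N}"
    have "(N choose i) * (i choose j) = (N choose j) * ((N - j) choose (i - j))"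
      using i by (intro choose_mult) auto
    then have "real (N choose i) * real (i choose j) = real (N choose j) * real ((N - j) choose (i - j))"
      by (metis of_nat_mult)
    moreover have "real (N choose j) > 0" using assms by simp
    ultimately have "real ((N - j) choose (i - j)) = real (i choose j) / real (N choose j) * real (N choose i)"
      by (simp add: nonzero_eq_divide_eq mult.commute)
    moreover have "t ^ j * t ^ (i - j) = t ^ i" using i by (simp flip: power_add)
    moreover have "N - j - (i - j) = N - i" using i by simp
    ultimately show "t ^ j * Bernstein (N - j) (i - j) t = real (i choose j) / real (N choose j) * Bernstein N i t"
      unfolding Bernstein_def by (metis mult.assoc mult.left_commute)
  qed (use assms in auto)
  also have "\<dots> = t ^ j" by (simp flip: sum_distrib_left)
  finally show ?thesis .
qed

lemma Bernstein_hahn_Q: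
  assumes "k \<le> N"
  shows "(\<Sum>i\<le>N. hahn_Q \<alpha> \<alpha> N k (real i) * Bernstein N i t) = poly (jac \<alpha> k) t"
proof -
  have "(\<Sum>i\<le>N. hahn_Q \<alpha> \<alpha> N k (real i) * Bernstein N i t)
    = (\<Sum>i\<le>N. \<Sum>j\<le>k. jcoeff \<alpha> k j * (pochhammer (- real i) j / pochhammer (- real N) j * Bernstein N i t))"
    by (simp add: hahn_Q_def jcoeff_def sum_distrib_right add_ac) (simp add: mult_ac)
  also have "\<dots> = (\<Sum>j\<le>k. jcoeff \<alpha> k j * (\<Sum>i\<le>N. pochhammer (- real i) j / pochhammer (- real N) j * Bernstein N i t))"
    by (subst sum.swap) (simp add: sum_distrib_left)
  also have "\<dots> = poly (jac \<alpha> k) t"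
    unfolding poly_jac using assms
    by (intro sum.cong refl arg_cong2[where f = "(*)"] sum_binomial_Bernstein) auto
  finally show ?thesis .
qed

section \<open>The differential equation and its consequences\<close>

definition jeig :: "real \<Rightarrow> nat \<Rightarrow> real" where
  "jeig \<alpha> k = real k * (real k + 2 * \<alpha> + 1)"

lemma jeig_nonneg: "\<alpha> \<ge> 0 \<Longrightarrow> jeig \<alpha> k \<ge> 0"
  by (simp add: jeig_def)

lemma pderiv_jac:
  "pderiv (jac \<alpha> (Suc k)) = smult (- (jeig \<alpha> (Suc k) / (\<alpha> + 1))) (jac (\<alpha> + 1) k)"
proof (rule poly_eqI)
  fix j
  have p: "pochhammer (- real (Suc k)) (Suc j) = - real (Suc k) * pochhammer (- real k) j"
    "pochhammer (real (Suc k) + 2 * \<alpha> + 1) (Suc j) =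
       (real (Suc k) + 2 * \<alpha> + 1) * pochhammer (real k + 2 * (\<alpha> + 1) + 1) j"
    "pochhammer (\<alpha> + 1) (Suc j) = (\<alpha> + 1) * pochhammer (\<alpha> + 1 + 1) j"
    unfolding pochhammer_rec by (simp_all add: algebra_simps)
  have gen: "s * ((- K * P) * (L * Q) / ((a * A) * (s * F))) = - (K * L / a) * (P * Q / (A * F))"
    if "s \<noteq> 0" for s K P L Q a A F :: real
    using that by (simp add: mult_ac)
  show "coeff (pderiv (jac \<alpha> (Suc k))) j =
        coeff (smult (- (jeig \<alpha> (Suc k) / (\<alpha> + 1))) (jac (\<alpha> + 1) k)) j"
    unfolding coeff_pderiv coeff_smult coeff_jac jcoeff_def jeig_def p fact_Suc
    by (rule gen) simp
qed

lemma jcoeff_Suc: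
  assumes "\<alpha> \<ge> 0"
  shows "jcoeff \<alpha> k (Suc j) * ((real j + 1) * (\<alpha> + 1 + real j))
       = jcoeff \<alpha> k j * ((real j - real k) * (real k + 2 * \<alpha> + 1 + real j))"
proof -
  have nz: "pochhammer (\<alpha> + 1) j > 0"
    using assms by (intro pochhammer_pos) auto
  have gen: "(P * p) * (Q * q) / ((A * a) * (s * F)) * (s * a) = P * Q / (A * F) * (p * q)"
    if "s \<noteq> 0" "a \<noteq> 0" for P p Q q A a s F :: real
    using that by (simp add: mult_ac)
  have e: "- real k + real j = real j - real k" "real j + 1 = real (Suc j)" by simp_all
  have "\<alpha> + 1 + real j \<noteq> 0" using assms by linarith
  then show ?thesis
    unfolding jcoeff_def pochhammer_Suc fact_Suc e by (intro gen) simp_all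
qed

lemma jac_ode_poly:
  assumes "\<alpha> \<ge> 0"
  shows "[:0, 1, -1:] * pderiv (pderiv (jac \<alpha> k)) + smult (\<alpha> + 1) ([:1, -2:] * pderiv (jac \<alpha> k))
    + smult (jeig \<alpha> k) (jac \<alpha> k) = 0"
proof (rule poly_eqI)
  fix n
  define c where "c = jcoeff \<alpha> k"
  have rec: "c (Suc j) * ((real j + 1) * (\<alpha> + 1 + real j))
       = c j * ((real j - real k) * (real k + 2 * \<alpha> + 1 + real j))" for j
    unfolding c_def by (rule jcoeff_Suc[OF assms])
  show "coeff ([:0, 1, -1:] * pderiv (pderiv (jac \<alpha> k)) + smult (\<alpha> + 1) ([:1, -2:] * pderiv (jac \<alpha> k))
    + smult (jeig \<alpha> k) (jac \<alpha> k)) n = coeff 0 n"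
  proof (cases n)
    case 0
    then show ?thesis
      using rec[of 0] by (simp add: coeff_pCons coeff_pderiv coeff_jac jeig_def c_def algebra_simps)
  next
    case (Suc m)
    show ?thesis
    proof (cases m)
      case 0
      with Suc have n: "n = Suc 0" by simp
      show ?thesis using rec[of 1] unfolding n
        by (simp add: coeff_pCons coeff_pderiv coeff_jac jeig_def c_def[symmetric] algebra_simps numeral_2_eq_2)
    next
      case (Suc l)
      with \<open>n = Suc m\<close> have n: "n = Suc (Suc l)" by simp
      show ?thesis using rec[of "Suc (Suc l)"] unfolding n
        by (simp add: coeff_pCons coeff_pderiv coeff_jac jeig_def c_def[symmetric] algebra_simps)
    qed
  qed
qed

lemma jac_ode:
  assumes "\<alpha> \<ge> 0"
  shows "t * (1 - t) * poly (pderiv (pderiv (jac \<alpha> k))) t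
     = - ((\<alpha> + 1) * (1 - 2 * t) * poly (pderiv (jac \<alpha> k)) t) - jeig \<alpha> k * poly (jac \<alpha> k) t"
  using arg_cong[OF jac_ode_poly[OF assms, of k], of "\<lambda>p. poly p t"] by (simp add: algebra_simps)

text \<open>
  By the differential equation the left-hand side has derivative
  \<open>- (2 \<alpha> + 1) (1 - 2 t) (R')\<^sup>2\<close>: it decreases up to \<open>t = 1/2\<close>, increases afterwards, and at both endpoints
  equals the right-hand side.
\<close>

lemma jac_sonin:
  assumes "\<alpha> \<ge> 0" "0 \<le> t" "t \<le> 1"
  shows "jeig \<alpha> k * (poly (jac \<alpha> k) t)\<^sup>2 + t * (1 - t) * (poly (pderiv (jac \<alpha> k)) t)\<^sup>2 \<le> jeig \<alpha> k"
proof -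
  define R where "R = poly (jac \<alpha> k)"
  define R' where "R' = poly (pderiv (jac \<alpha> k))"
  define R'' where "R'' = poly (pderiv (pderiv (jac \<alpha> k)))"
  define E where "E = (\<lambda>t. jeig \<alpha> k * (R t)\<^sup>2 + t * (1 - t) * (R' t)\<^sup>2)"
  have dR: "(R has_real_derivative R' s) (at s)" "(R' has_real_derivative R'' s) (at s)" for s
    unfolding R_def R'_def R''_def by (rule poly_DERIV)+
  have dE: "(E has_real_derivative - ((2 * \<alpha> + 1) * (1 - 2 * s) * (R' s)\<^sup>2)) (at s)" for s
  proof -
    have ode: "s * (1 - s) * R'' s = - ((\<alpha> + 1) * (1 - 2 * s) * R' s) - jeig \<alpha> k * R s"
      unfolding R_def R'_def R''_def by (rule jac_ode[OF assms(1)])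
    have "(E has_real_derivative (jeig \<alpha> k * (2 * R s * R' s) + ((1 - 2 * s) * (R' s)\<^sup>2
              + 2 * (s * (1 - s) * R'' s) * R' s))) (at s)"
      unfolding E_def by (auto intro!: derivative_eq_intros dR simp: power2_eq_square algebra_simps)
    also have "jeig \<alpha> k * (2 * R s * R' s) + ((1 - 2 * s) * (R' s)\<^sup>2
              + 2 * (s * (1 - s) * R'' s) * R' s) = - ((2 * \<alpha> + 1) * (1 - 2 * s) * (R' s)\<^sup>2)"
      unfolding ode by (simp add: power2_eq_square algebra_simps)
    finally show ?thesis .
  qed
  have ends: "E 0 = jeig \<alpha> k" "E 1 = jeig \<alpha> k"
    using poly_jac_reflect[OF assms(1), of k 0]
    by (simp_all add: E_def R_def power2_eq_square flip: power_mult_distrib)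
  have "E t \<le> jeig \<alpha> k"
  proof (cases "t \<le> 1/2")
    case True
    have "E t \<le> E 0"
    proof (rule DERIV_nonpos_imp_nonincreasing[of 0 t E])
      fix s assume "0 \<le> s" "s \<le> t"
      then have "(2 * \<alpha> + 1) * (1 - 2 * s) * (R' s)\<^sup>2 \<ge> 0" using True assms by auto
      then show "\<exists>y. (E has_real_derivative y) (at s) \<and> y \<le> 0"
        using dE[of s] by (metis neg_le_0_iff_le)
    qed (use assms in auto)
    then show ?thesis by (simp add: ends)
  next
    case False
    have "E t \<le> E 1"
    proof (rule DERIV_nonneg_imp_nondecreasing[of t 1 E])
      fix s assume "t \<le> s" "s \<le> 1"
      then have "(2 * \<alpha> + 1) * (1 - 2 * s) * (R' s)\<^sup>2 \<le> 0"
        using False assms by (intro mult_nonpos_nonneg mult_nonneg_nonpos) auto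
      then show "\<exists>y. (E has_real_derivative y) (at s) \<and> 0 \<le> y"
        using dE[of s] by (metis neg_0_le_iff_le)
    qed (use assms in auto)
    then show ?thesis by (simp add: ends)
  qed
  then show ?thesis by (simp add: E_def R_def R'_def)
qed

lemma abs_jac_le_1:
  assumes "\<alpha> \<ge> 0" "0 \<le> t" "t \<le> 1"
  shows "\<bar>poly (jac \<alpha> k) t\<bar> \<le> 1"
proof (cases "k = 0")
  case False
  then have pos: "jeig \<alpha> k > 0" using assms by (simp add: jeig_def)
  have "0 \<le> t * (1 - t) * (poly (pderiv (jac \<alpha> k)) t)\<^sup>2" using assms by simp
  with jac_sonin[OF assms, of k] have "jeig \<alpha> k * (poly (jac \<alpha> k) t)\<^sup>2 \<le> jeig \<alpha> k * 1" by simp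
  then have "(poly (jac \<alpha> k) t)\<^sup>2 \<le> 1" using pos by (simp only: mult_le_cancel_left_pos)
  then show ?thesis by (simp add: abs_square_le_1)
qed simp

lemma jac_bernstein_inequality:
  assumes "\<alpha> \<ge> 0" "0 \<le> t" "t \<le> 1"
  shows "sqrt (t * (1 - t)) * \<bar>poly (pderiv (jac \<alpha> k)) t\<bar> \<le> sqrt (jeig \<alpha> k)"
proof -
  have "0 \<le> jeig \<alpha> k * (poly (jac \<alpha> k) t)\<^sup>2" using jeig_nonneg[OF assms(1)] by simp
  with jac_sonin[OF assms, of k] have "t * (1 - t) * (poly (pderiv (jac \<alpha> k)) t)\<^sup>2 \<le> jeig \<alpha> k" by simp
  then have "sqrt (t * (1 - t) * (poly (pderiv (jac \<alpha> k)) t)\<^sup>2) \<le> sqrt (jeig \<alpha> k)"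
    by (rule real_sqrt_le_mono)
  then show ?thesis by (simp add: real_sqrt_mult)
qed

text \<open>
  The derivative is a multiple of a polynomial of the same family with parameter \<open>\<alpha> + 1\<close>, which again
  is bounded by \<open>1\<close>.
\<close>

lemma abs_pderiv_jac_le:
  assumes "\<alpha> \<ge> 0" "0 \<le> t" "t \<le> 1"
  shows "(\<alpha> + 1) * \<bar>poly (pderiv (jac \<alpha> k)) t\<bar> \<le> jeig \<alpha> k"
proof (cases k)
  case 0
  then show ?thesis by (simp add: jeig_def)
next
  case (Suc m)
  have "(\<alpha> + 1) * \<bar>poly (pderiv (jac \<alpha> k)) t\<bar> = jeig \<alpha> k * \<bar>poly (jac (\<alpha> + 1) m) t\<bar>"
    unfolding Suc pderiv_jac using assms jeig_nonneg[OF assms(1), of "Suc m"]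
    by (simp add: abs_mult)
  also have "\<dots> \<le> jeig \<alpha> k * 1"
    using assms jeig_nonneg[OF assms(1)] by (intro mult_left_mono abs_jac_le_1) auto
  finally show ?thesis by simp
qed

lemma abs_pderiv2_jac_le:
  assumes "\<alpha> \<ge> 0" "0 \<le> t" "t \<le> 1"
  shows "t * (1 - t) * \<bar>poly (pderiv (pderiv (jac \<alpha> k))) t\<bar> \<le> 2 * jeig \<alpha> k"
proof -
  have "t * (1 - t) * \<bar>poly (pderiv (pderiv (jac \<alpha> k))) t\<bar> = \<bar>t * (1 - t) * poly (pderiv (pderiv (jac \<alpha> k))) t\<bar>"
    using assms by (simp add: abs_mult)
  also have "\<dots> \<le> \<bar>(\<alpha> + 1) * (1 - 2 * t) * poly (pderiv (jac \<alpha> k)) t\<bar> + \<bar>jeig \<alpha> k * poly (jac \<alpha> k) t\<bar>"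
    unfolding jac_ode[OF assms(1)] by linarith
  also have "\<bar>(\<alpha> + 1) * (1 - 2 * t) * poly (pderiv (jac \<alpha> k)) t\<bar>
      = \<bar>1 - 2 * t\<bar> * ((\<alpha> + 1) * \<bar>poly (pderiv (jac \<alpha> k)) t\<bar>)"
    using assms by (simp add: abs_mult)
  also have "\<dots> \<le> 1 * jeig \<alpha> k"
    using assms jeig_nonneg[OF assms(1), of k] by (intro mult_mono abs_pderiv_jac_le) auto
  also have "\<bar>jeig \<alpha> k * poly (jac \<alpha> k) t\<bar> \<le> jeig \<alpha> k * 1"
    unfolding abs_mult using assms jeig_nonneg[OF assms(1), of k]
    by (intro mult_mono abs_jac_le_1) auto
  finally show ?thesis by simp
qed

section \<open>Expectations under Beta distributions\<close>

text \<open>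
  The left-hand side is the relative entropy of two Bernoulli distributions, the right-hand side their
  \<open>\<chi>\<^sup>2\<close>-divergence.
\<close>

lemma binary_entropy_bregman_le:
  fixes t m :: real
  assumes "0 < t" "t < 1" "0 < m" "m < 1"
  shows "t * ln t + (1 - t) * ln (1 - t) - (m * ln m + (1 - m) * ln (1 - m))
           - (ln m - ln (1 - m)) * (t - m) \<le> (t - m)\<^sup>2 / (m * (1 - m))"
proof -
  have "t * (ln t - ln m) \<le> t * (t / m - 1)"
    using assms ln_le_minus_one[of "t / m"] by (intro mult_left_mono) (auto simp: ln_div)
  moreover have "(1 - t) * (ln (1 - t) - ln (1 - m)) \<le> (1 - t) * ((1 - t) / (1 - m) - 1)"
    using assms ln_le_minus_one[of "(1 - t) / (1 - m)"] by (intro mult_left_mono) (auto simp: ln_div)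
  moreover have "t * (t / m - 1) + (1 - t) * ((1 - t) / (1 - m) - 1) = (t - m)\<^sup>2 / (m * (1 - m))"
    using assms by (simp add: field_simps power2_eq_square)
  ultimately show ?thesis by (simp add: algebra_simps)
qed

text \<open>
  The negative binary entropy \<open>H\<close> satisfies \<open>H''(s) = 1 / (s (1 - s))\<close>, so \<open>M H + F\<close> and \<open>M H - F\<close> are
  convex and the remainder of \<open>F\<close> is at most \<open>M\<close> times that of \<open>H\<close>.
\<close>

lemma taylor_remainder_singular:
  fixes F F' F'' :: "real \<Rightarrow> real"
  assumes dF: "\<And>s. 0 < s \<Longrightarrow> s < 1 \<Longrightarrow> (F has_real_derivative F' s) (at s)"
    and dF': "\<And>s. 0 < s \<Longrightarrow> s < 1 \<Longrightarrow> (F' has_real_derivative F'' s) (at s)"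
    and bound: "\<And>s. 0 < s \<Longrightarrow> s < 1 \<Longrightarrow> s * (1 - s) * \<bar>F'' s\<bar> \<le> M"
    and t: "0 < t" "t < 1" and m: "0 < m" "m < 1"
  shows "\<bar>F t - F m - F' m * (t - m)\<bar> \<le> M * ((t - m)\<^sup>2 / (m * (1 - m)))"
proof -
  have M: "0 \<le> M"
    using bound[OF m] m by (meson abs_ge_zero diff_ge_0_iff_ge less_imp_le mult_nonneg_nonneg order_trans)
  \<comment> \<open>The negative binary entropy, with \<open>H''(s) = 1 / (s (1 - s))\<close>.\<close>
  define H where "H = (\<lambda>s::real. s * ln s + (1 - s) * ln (1 - s))"
  have *: "- c * (F t - F m - F' m * (t - m)) \<le> M * ((t - m)\<^sup>2 / (m * (1 - m)))"
    if c: "\<bar>c\<bar> = 1" for c :: real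
  proof -
    have "(M * (ln m - ln (1 - m)) + c * F' m) * (t - m)
            \<le> (M * H t + c * F t) - (M * H m + c * F m)"
    proof (rule f''_imp_f'[where C = "{0<..<1}" and f = "\<lambda>s. M * H s + c * F s"
          and f' = "\<lambda>s. M * (ln s - ln (1 - s)) + c * F' s"
          and f'' = "\<lambda>s. M * (1 / s + 1 / (1 - s)) + c * F'' s"])
      fix s :: real assume "s \<in> {0<..<1}"
      then have s: "0 < s" "s < 1" by auto
      show "((\<lambda>s. M * H s + c * F s) has_real_derivative M * (ln s - ln (1 - s)) + c * F' s) (at s)"
      proof -
        have "(H has_real_derivative ln s - ln (1 - s)) (at s)"
          unfolding H_def by (rule derivative_eq_intros refl | use s in simp)+
        then show ?thesis by (intro DERIV_add DERIV_cmult dF s)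
      qed
      show "((\<lambda>s. M * (ln s - ln (1 - s)) + c * F' s) has_real_derivative
               M * (1 / s + 1 / (1 - s)) + c * F'' s) (at s)"
        using s by (auto intro!: derivative_eq_intros dF' simp: field_simps)
      have "M * (1 / s + 1 / (1 - s)) = M / (s * (1 - s))"
        using s by (simp add: field_simps)
      moreover have "\<bar>c * F'' s\<bar> \<le> M / (s * (1 - s))"
        using bound[OF s] s c by (simp add: abs_mult pos_le_divide_eq mult.commute)
      ultimately show "0 \<le> M * (1 / s + 1 / (1 - s)) + c * F'' s" by linarith
    qed (use t m in auto)
    then have "- c * (F t - F m - F' m * (t - m)) \<le> M * (H t - H m - (ln m - ln (1 - m)) * (t - m))"
      by (simp add: algebra_simps)
    also have "\<dots> \<le> M * ((t - m)\<^sup>2 / (m * (1 - m)))"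
      using binary_entropy_bregman_le[OF t m] M unfolding H_def by (intro mult_left_mono) auto
    finally show ?thesis .
  qed
  show ?thesis using *[of 1] *[of "-1"] by (simp add: abs_le_iff)
qed

text \<open>
  At \<open>t = 0\<close> and \<open>t = 1\<close> the kernel vanishes even when an exponent is \<open>0\<close>, as \<open>0 powr 0 = 0\<close>.
\<close>

definition beta_kernel :: "real \<Rightarrow> real \<Rightarrow> real \<Rightarrow> real" where
  "beta_kernel a b t = t powr (a - 1) * (1 - t) powr (b - 1)"

lemma beta_kernel_nonneg: "0 \<le> beta_kernel a b t"
  by (simp add: beta_kernel_def)

lemma Beta_pos: "0 < a \<Longrightarrow> 0 < b \<Longrightarrow> Beta a b > (0::real)"
  by (simp add: Beta_def Gamma_real_pos)

lemma Beta_plus_nat: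
  fixes a b :: real
  assumes "0 < a" "0 < b"
  shows "Beta (a + real j) b = Beta a b * (pochhammer a j / pochhammer (a + b) j)"
proof (induction j)
  case (Suc j)
  have "(a + real j + b) * Beta (a + real j + 1) b = (a + real j) * Beta (a + real j) b"
    using assms by (intro Beta_plus1_left) (auto elim!: nonpos_Ints_cases)
  then have "Beta (a + real (Suc j)) b = (a + real j) / (a + b + real j) * Beta (a + real j) b"
    using assms by (simp add: field_simps)
  also have "\<dots> = Beta a b * (pochhammer a (Suc j) / pochhammer (a + b) (Suc j))"
    by (simp add: Suc.IH pochhammer_Suc mult_ac)
  finally show ?case .
qed simp

lemma has_integral_power_beta_kernel:
  assumes "0 < a" "0 < b"
  shows "((\<lambda>t. t ^ j * beta_kernel a b t) has_integral
            Beta a b * (pochhammer a j / pochhammer (a + b) j)) {0..1}"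
proof -
  have "((\<lambda>t. beta_kernel (a + real j) b t) has_integral Beta (a + real j) b) {0..1}"
    unfolding beta_kernel_def using assms by (intro has_integral_Beta_real) auto
  then have "((\<lambda>t. t ^ j * beta_kernel a b t) has_integral Beta (a + real j) b) {0..1}"
  proof (rule has_integral_spike_finite[of "{0}", rotated 2])
    fix t :: real assume "t \<in> {0..1} - {0}"
    then have "t powr (a + real j - 1) = t ^ j * t powr (a - 1)"
      by (simp add: powr_realpow [symmetric] flip: powr_add) (simp add: algebra_simps)
    then show "t ^ j * beta_kernel a b t = beta_kernel (a + real j) b t"
      by (simp add: beta_kernel_def)
  qed auto
  then show ?thesis by (simp add: Beta_plus_nat[OF assms])
qed

text \<open>
  Integrating the remainder bound leaves the variance, which for the Beta distribution is
  \<open>m (1 - m) / (a + b + 1)\<close> with mean \<open>m = a / (a + b)\<close>; its factor \<open>m (1 - m)\<close> cancels the singular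
  denominator.
\<close>

lemma beta_expectation_bound:
  fixes F F' F'' :: "real \<Rightarrow> real"
  assumes a: "0 < a" and b: "0 < b"
    and dF: "\<And>s. 0 < s \<Longrightarrow> s < 1 \<Longrightarrow> (F has_real_derivative F' s) (at s)"
    and dF': "\<And>s. 0 < s \<Longrightarrow> s < 1 \<Longrightarrow> (F' has_real_derivative F'' s) (at s)"
    and bound: "\<And>s. 0 < s \<Longrightarrow> s < 1 \<Longrightarrow> s * (1 - s) * \<bar>F'' s\<bar> \<le> M"
    and I: "((\<lambda>t. F t * beta_kernel a b t) has_integral I) {0..1}"
  shows "\<bar>I - F (a / (a + b)) * Beta a b\<bar> \<le> M * Beta a b / (a + b + 1)"
proof -
  define m where "m = a / (a + b)"
  have m: "0 < m" "m < 1" using a b by (auto simp: m_def)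
  have mom: "((\<lambda>t. beta_kernel a b t) has_integral Beta a b) {0..1}"
    "((\<lambda>t. t * beta_kernel a b t) has_integral Beta a b * m) {0..1}"
    "((\<lambda>t. t ^ 2 * beta_kernel a b t) has_integral Beta a b * (a * (a + 1) / ((a + b) * (a + b + 1)))) {0..1}"
    using has_integral_power_beta_kernel[OF a b, of 0] has_integral_power_beta_kernel[OF a b, of 1]
      has_integral_power_beta_kernel[OF a b, of 2]
    by (simp_all add: m_def numeral_2_eq_2 pochhammer_Suc)
  have var: "((\<lambda>t. (t - m)\<^sup>2 * beta_kernel a b t) has_integral m * (1 - m) * Beta a b / (a + b + 1)) {0..1}"
  proof -
    have "((\<lambda>t. t ^ 2 * beta_kernel a b t - 2 * m * (t * beta_kernel a b t) + m\<^sup>2 * beta_kernel a b t) has_integral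
       Beta a b * (a * (a + 1) / ((a + b) * (a + b + 1))) - 2 * m * (Beta a b * m) + m\<^sup>2 * Beta a b) {0..1}"
      by (intro has_integral_add has_integral_diff has_integral_mult_right mom)
    moreover have "Beta a b * (a * (a + 1) / ((a + b) * (a + b + 1))) - 2 * m * (Beta a b * m) + m\<^sup>2 * Beta a b
        = m * (1 - m) * Beta a b / (a + b + 1)"
    proof -
      have "a * (a + 1) / ((a + b) * (a + b + 1)) - m\<^sup>2 = m * (1 - m) / (a + b + 1)"
      proof -
        have "a + b \<noteq> 0" "a + b + 1 \<noteq> 0" using a b by auto
        then show ?thesis unfolding m_def by (simp add: divide_simps power2_eq_square) (simp add: algebra_simps)
      qed
      then have "Beta a b * (a * (a + 1) / ((a + b) * (a + b + 1)) - m\<^sup>2) = Beta a b * (m * (1 - m) / (a + b + 1))" by simp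
      then show ?thesis by (simp add: algebra_simps power2_eq_square)
    qed
    ultimately show ?thesis by (simp add: power2_eq_square algebra_simps)
  qed
  define D where "D = (\<lambda>t. (F t - F m - F' m * (t - m)) * beta_kernel a b t)"
  have "((\<lambda>t. F t * beta_kernel a b t - F m * beta_kernel a b t - F' m * (t * beta_kernel a b t - m * beta_kernel a b t))
      has_integral I - F m * Beta a b - F' m * (Beta a b * m - m * Beta a b)) {0..1}"
    by (intro has_integral_diff has_integral_mult_right mom I)
  then have D: "(D has_integral I - F m * Beta a b) {0..1}"
    by (simp add: D_def algebra_simps)
  have U: "((\<lambda>t. M / (m * (1 - m)) * ((t - m)\<^sup>2 * beta_kernel a b t)) has_integral
      M / (m * (1 - m)) * (m * (1 - m) * Beta a b / (a + b + 1))) {0..1}"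
    by (intro has_integral_mult_right var)
  have le: "\<bar>D t\<bar> \<le> M / (m * (1 - m)) * ((t - m)\<^sup>2 * beta_kernel a b t)" if "t \<in> {0..1}" for t
  proof (cases "t = 0 \<or> t = 1")
    case True
    then have "beta_kernel a b t = 0" by (auto simp: beta_kernel_def)
    then show ?thesis by (simp add: D_def)
  next
    case False
    with that have "0 < t" "t < 1" by auto
    from taylor_remainder_singular[OF dF dF' bound this m]
    have "\<bar>F t - F m - F' m * (t - m)\<bar> * beta_kernel a b t \<le> M * ((t - m)\<^sup>2 / (m * (1 - m))) * beta_kernel a b t"
      by (intro mult_right_mono beta_kernel_nonneg) auto
    then show ?thesis by (simp add: D_def abs_mult beta_kernel_nonneg mult_ac)
  qed
  have "I - F m * Beta a b \<le> M / (m * (1 - m)) * (m * (1 - m) * Beta a b / (a + b + 1))"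
    by (rule has_integral_le[OF D U]) (use le in force)
  moreover have "- (I - F m * Beta a b) \<le> M / (m * (1 - m)) * (m * (1 - m) * Beta a b / (a + b + 1))"
    by (rule has_integral_le[OF has_integral_neg[OF D] U]) (use le in force)
  moreover have "M / (m * (1 - m)) * (m * (1 - m) * Beta a b / (a + b + 1)) = M * Beta a b / (a + b + 1)"
    using m by simp
  ultimately show ?thesis by (simp add: m_def abs_le_iff)
qed

section \<open>Closeness of Hahn and Jacobi polynomials\<close>

text \<open>
  The transformed series of \<open>Q\<^sub>k\<close> has the moments of the Beta distribution as its coefficients.  The
  argument \<open>y\<close> may be any real number in \<open>[0,N]\<close>, and this gives bounds off the grid as well.
\<close>

lemma has_integral_jac_beta_kernel:
  assumes "\<alpha> \<ge> 0" "k \<le> N" "0 \<le> y" "y \<le> real N"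
  shows "((\<lambda>s. poly (jac \<alpha> k) s * beta_kernel (y + \<alpha> + 1) (real N - y + \<alpha> + 1) s) has_integral
           durrmeyer_eig \<alpha> N k * hahn_Q \<alpha> \<alpha> N k y * Beta (y + \<alpha> + 1) (real N - y + \<alpha> + 1)) {0..1}"
proof -
  let ?a = "y + \<alpha> + 1" and ?b = "real N - y + \<alpha> + 1"
  have ab: "?a + ?b = real N + 2 * \<alpha> + 2" by simp
  have "((\<lambda>s. \<Sum>j\<le>k. jcoeff \<alpha> k j * (s ^ j * beta_kernel ?a ?b s)) has_integral
     (\<Sum>j\<le>k. jcoeff \<alpha> k j * (Beta ?a ?b * (pochhammer ?a j / pochhammer (?a + ?b) j)))) {0..1}"
    using assms by (intro has_integral_sum has_integral_mult_right has_integral_power_beta_kernel) auto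
  moreover have "(\<Sum>j\<le>k. jcoeff \<alpha> k j * (Beta ?a ?b * (pochhammer ?a j / pochhammer (?a + ?b) j)))
     = durrmeyer_eig \<alpha> N k * hahn_Q \<alpha> \<alpha> N k y * Beta ?a ?b"
    unfolding ab hahn_Q_transform[OF assms(1,2)] sum_distrib_right by (simp add: mult_ac)
  moreover have "(\<lambda>s. \<Sum>j\<le>k. jcoeff \<alpha> k j * (s ^ j * beta_kernel ?a ?b s))
     = (\<lambda>s. poly (jac \<alpha> k) s * beta_kernel ?a ?b s)"
    by (simp add: poly_jac sum_distrib_right mult.assoc)
  ultimately show ?thesis by simp
qed

lemma durrmeyer_eig_0 [simp]: "durrmeyer_eig \<alpha> N 0 = 1"
  by (simp add: durrmeyer_eig_def)

lemma durrmeyer_eig_Suc: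
  "durrmeyer_eig \<alpha> N (Suc k) = durrmeyer_eig \<alpha> N k * ((real N - real k) / (real N + 2 * \<alpha> + 2 + real k))"
proof -
  have e: "real N + 1 - real (Suc k) = real N - real k" "real N - real k + 1 = real N + 1 - real k"
    by simp_all
  have "pochhammer (real N + 1 - real (Suc k)) (Suc k) = (real N - real k) * pochhammer (real N + 1 - real k) k"
    unfolding e(1) pochhammer_rec e(2) by (rule refl)
  then show ?thesis by (simp add: durrmeyer_eig_def pochhammer_Suc del: of_nat_Suc)
qed

lemma jeig_Suc: "jeig \<alpha> (Suc k) = jeig \<alpha> k + (2 * \<alpha> + 2 + 2 * real k)"
  by (simp add: jeig_def algebra_simps)

lemma durrmeyer_eig_bounds:
  assumes "\<alpha> \<ge> 0" "k \<le> N"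
  shows "0 < durrmeyer_eig \<alpha> N k" "durrmeyer_eig \<alpha> N k \<le> 1"
    "1 - durrmeyer_eig \<alpha> N k \<le> jeig \<alpha> k / real N"
proof -
  have "0 < durrmeyer_eig \<alpha> N k \<and> durrmeyer_eig \<alpha> N k \<le> 1 \<and> 1 - durrmeyer_eig \<alpha> N k \<le> jeig \<alpha> k / real N"
    using assms(2)
  proof (induction k)
    case 0
    then show ?case by (simp add: jeig_def)
  next
    case (Suc k)
    define \<mu> where "\<mu> = durrmeyer_eig \<alpha> N k"
    define r where "r = (real N - real k) / (real N + 2 * \<alpha> + 2 + real k)"
    have IH: "0 < \<mu>" "\<mu> \<le> 1" "1 - \<mu> \<le> jeig \<alpha> k / real N"
      using Suc by (auto simp: \<mu>_def)
    have r: "0 < r" "r \<le> 1" using Suc.prems assms(1) by (auto simp: r_def)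
    define d where "d = (2 * \<alpha> + 2 + 2 * real k) / real N"
    have "1 - r = (2 * \<alpha> + 2 + 2 * real k) / (real N + 2 * \<alpha> + 2 + real k)"
      using assms(1) by (simp add: r_def field_simps)
    also have "\<dots> \<le> (2 * \<alpha> + 2 + 2 * real k) / real N"
      using assms(1) Suc.prems by (intro divide_left_mono) auto
    finally have "1 - r \<le> d" by (simp add: d_def)
    moreover have "\<mu> * (1 - r) \<le> 1 * (1 - r)" using IH r by (intro mult_right_mono) auto
    ultimately have "(1 - \<mu>) + \<mu> * (1 - r) \<le> jeig \<alpha> k / real N + d"
      using IH(3) by (intro add_mono) auto
    then have "1 - \<mu> * r \<le> jeig \<alpha> k / real N + d" by (simp add: algebra_simps)
    moreover have "durrmeyer_eig \<alpha> N (Suc k) = \<mu> * r" by (simp add: durrmeyer_eig_Suc \<mu>_def r_def)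
    moreover have "0 < \<mu> * r" "\<mu> * r \<le> 1" using IH r by (auto intro: mult_le_one)
    ultimately show ?case by (simp add: jeig_Suc add_divide_distrib d_def)
  qed
  then show "0 < durrmeyer_eig \<alpha> N k" "durrmeyer_eig \<alpha> N k \<le> 1"
    "1 - durrmeyer_eig \<alpha> N k \<le> jeig \<alpha> k / real N" by auto
qed

text \<open>
  Up to \<open>k = N/2 + 1\<close> each factor \<open>(N - j) / (N + 2 \<alpha> + 2 + j)\<close> with \<open>j < k\<close> is at least
  \<open>exp (- 2 (2 \<alpha> + 2 + 2 j) / N)\<close>, because \<open>N - j \<ge> N/2\<close>, and the numbers \<open>2 \<alpha> + 2 + 2 j\<close> add up
  to \<open>jeig \<alpha> k\<close>.
\<close>

lemma durrmeyer_eig_lower: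
  assumes "\<alpha> \<ge> 0" "2 * k \<le> N + 2" "N \<ge> 1"
  shows "exp (- (2 * jeig \<alpha> k / real N)) \<le> durrmeyer_eig \<alpha> N k"
  using assms(2)
proof (induction k)
  case 0
  then show ?case by (simp add: jeig_def)
next
  case (Suc k)
  have "2 * k \<le> N" using Suc.prems by simp
  then have "real (2 * k) \<le> real N" by (simp only: of_nat_le_iff)
  then have N: "real N > 0" "real N \<le> 2 * (real N - real k)" using assms(3) by auto
  define c where "c = 2 * \<alpha> + 2 + 2 * real k"
  have c: "c > 0" using assms(1) by (simp add: c_def)
  have "(real N + 2 * \<alpha> + 2 + real k) / (real N - real k) = 1 + c / (real N - real k)"
    using N by (simp add: c_def field_simps)
  also have "c / (real N - real k) \<le> 2 * c / real N"
    using N c mult_left_mono[OF N(2), of c] by (simp add: field_simps)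
  also have "1 + 2 * c / real N \<le> exp (2 * c / real N)" by (rule exp_ge_add_one_self)
  finally have "(real N + 2 * \<alpha> + 2 + real k) / (real N - real k) \<le> exp (2 * c / real N)" by simp
  moreover have "(real N + 2 * \<alpha> + 2 + real k) / (real N - real k) > 0" using N assms(1) by simp
  ultimately have "inverse (exp (2 * c / real N)) \<le> inverse ((real N + 2 * \<alpha> + 2 + real k) / (real N - real k))"
    by (rule le_imp_inverse_le)
  then have r: "exp (- (2 * c / real N)) \<le> (real N - real k) / (real N + 2 * \<alpha> + 2 + real k)"
    by (simp add: exp_minus)
  have "exp (- (2 * jeig \<alpha> (Suc k) / real N)) = exp (- (2 * jeig \<alpha> k / real N)) * exp (- (2 * c / real N))"
    by (simp add: jeig_Suc c_def add_divide_distrib algebra_simps flip: exp_add)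
  also have "\<dots> \<le> durrmeyer_eig \<alpha> N k * ((real N - real k) / (real N + 2 * \<alpha> + 2 + real k))"
    using Suc r durrmeyer_eig_bounds(1)[OF assms(1), of k N]
    by (intro mult_mono) auto
  finally show ?case by (simp add: durrmeyer_eig_Suc)
qed

text \<open>
  As an expectation of \<open>R\<^sub>k(S)\<close>, the number \<open>\<mu> q\<close> inherits the bound \<open>\<bar>R\<^sub>k\<bar> \<le> 1\<close>.  The variance of \<open>S\<close>
  accounts for two of the three multiples of \<open>jeig / N\<close>, and the distance of the mean of \<open>S\<close> from \<open>t\<close> for
  the third.
\<close>

lemma abs_hahn_Q_scaled_le:
  assumes "\<alpha> \<ge> 0" "k \<le> N" "0 \<le> t" "t \<le> 1" "N \<ge> 1"
  defines "\<mu> \<equiv> durrmeyer_eig \<alpha> N k" and "q \<equiv> hahn_Q \<alpha> \<alpha> N k (real N * t)"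
  shows "\<mu> * \<bar>q\<bar> \<le> 1" "\<bar>\<mu> * q - poly (jac \<alpha> k) t\<bar> \<le> 3 * jeig \<alpha> k / real N"
proof -
  let ?R = "poly (jac \<alpha> k)"
  define a where "a = real N * t + \<alpha> + 1"
  define b where "b = real N - real N * t + \<alpha> + 1"
  have y: "0 \<le> real N * t" "real N * t \<le> real N"
    using assms by (auto intro: mult_left_le)
  then have ab: "0 < a" "0 < b" "a + b = real N + 2 * \<alpha> + 2"
    using assms(1) unfolding a_def b_def by linarith+
  have int: "((\<lambda>s. ?R s * beta_kernel a b s) has_integral \<mu> * q * Beta a b) {0..1}"
    unfolding a_def b_def \<mu>_def q_def by (rule has_integral_jac_beta_kernel[OF assms(1,2) y])
  have one: "((\<lambda>s. beta_kernel a b s) has_integral Beta a b) {0..1}"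
    using has_integral_power_beta_kernel[OF ab(1,2), of 0] by simp
  have B: "Beta a b > 0" using ab by (intro Beta_pos) auto
  have \<mu>: "\<mu> > 0" unfolding \<mu>_def using assms by (intro durrmeyer_eig_bounds)
  have le: "\<bar>?R s * beta_kernel a b s\<bar> \<le> beta_kernel a b s" if "s \<in> {0..1}" for s
    using mult_right_mono[OF abs_jac_le_1[OF assms(1), of s k] beta_kernel_nonneg[of a b s]] that
    by (simp add: abs_mult beta_kernel_nonneg)
  have "\<mu> * q * Beta a b \<le> Beta a b"
    by (rule has_integral_le[OF int one]) (use le in force)
  moreover have "- (\<mu> * q * Beta a b) \<le> Beta a b"
    by (rule has_integral_le[OF has_integral_neg[OF int] one]) (use le in force)
  ultimately have "\<bar>\<mu> * q * Beta a b\<bar> \<le> 1 * Beta a b" by linarith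
  then have "\<bar>\<mu> * q\<bar> * Beta a b \<le> 1 * Beta a b" using B by (simp only: abs_mult[of _ "Beta a b"] abs_of_pos)
  then have "\<bar>\<mu> * q\<bar> \<le> 1" using B by (simp only: mult_le_cancel_right_pos)
  then show "\<mu> * \<bar>q\<bar> \<le> 1" using \<mu> by (simp add: abs_mult)
  define m where "m = a / (a + b)"
  have m: "0 < m" "m < 1" using ab by (auto simp: m_def)
  have N0: "real N > 0" using assms by simp
  have l: "jeig \<alpha> k \<ge> 0" by (rule jeig_nonneg[OF assms(1)])
  have "\<bar>\<mu> * q * Beta a b - ?R m * Beta a b\<bar> \<le> 2 * jeig \<alpha> k * Beta a b / (a + b + 1)"
    unfolding m_def
    by (rule beta_expectation_bound[OF ab(1,2) poly_DERIV poly_DERIV _ int])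
       (use abs_pderiv2_jac_le[OF assms(1)] in auto)
  then have "\<bar>\<mu> * q - ?R m\<bar> * Beta a b \<le> 2 * jeig \<alpha> k / (a + b + 1) * Beta a b"
    using B by (simp add: abs_mult flip: left_diff_distrib)
  then have "\<bar>\<mu> * q - ?R m\<bar> \<le> 2 * jeig \<alpha> k / (a + b + 1)"
    using B by (simp only: mult_le_cancel_right_pos)
  also have "\<dots> \<le> 2 * jeig \<alpha> k / real N"
    using l N0 ab assms(1) by (intro divide_left_mono) auto
  finally have 1: "\<bar>\<mu> * q - ?R m\<bar> \<le> 2 * jeig \<alpha> k / real N" .
  have "\<bar>?R m - ?R t\<bar> \<le> jeig \<alpha> k / (\<alpha> + 1) * \<bar>m - t\<bar>"
  proof -
    have "norm (?R m - ?R t) \<le> jeig \<alpha> k / (\<alpha> + 1) * norm (m - t)"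
    proof (rule field_differentiable_bound[of "{0..1}" ?R "poly (pderiv (jac \<alpha> k))"])
      fix s :: real assume s: "s \<in> {0..1}"
      show "(?R has_field_derivative poly (pderiv (jac \<alpha> k)) s) (at s within {0..1})"
        by (intro DERIV_subset[OF poly_DERIV]) auto
      show "norm (poly (pderiv (jac \<alpha> k)) s) \<le> jeig \<alpha> k / (\<alpha> + 1)"
        using abs_pderiv_jac_le[OF assms(1), of s k] s assms(1)
        by (simp add: pos_le_divide_eq mult.commute)
    qed (use m assms in auto)
    then show ?thesis by simp
  qed
  moreover have "\<bar>m - t\<bar> \<le> (\<alpha> + 1) / real N"
  proof -
    have "(m - t) * (a + b) = (\<alpha> + 1) * (1 - 2 * t)"
    proof -
      have "m * (a + b) = a" using ab by (simp add: m_def)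
      then show ?thesis by (simp add: left_diff_distrib ab(3)) (simp add: a_def algebra_simps)
    qed
    then have "\<bar>m - t\<bar> * (a + b) = (\<alpha> + 1) * \<bar>1 - 2 * t\<bar>"
      using ab assms(1) by (metis abs_mult abs_of_pos add_pos_pos abs_of_nonneg add_nonneg_nonneg zero_le_one)
    also have "\<dots> \<le> (\<alpha> + 1) * 1" using assms by (intro mult_left_mono) auto
    finally have "\<bar>m - t\<bar> * (a + b) \<le> \<alpha> + 1" by simp
    then have "\<bar>m - t\<bar> \<le> (\<alpha> + 1) / (a + b)" using ab by (simp add: pos_le_divide_eq)
    also have "\<dots> \<le> (\<alpha> + 1) / real N" using ab N0 assms(1) by (intro divide_left_mono) auto
    finally show ?thesis .
  qed
  then have "jeig \<alpha> k / (\<alpha> + 1) * \<bar>m - t\<bar> \<le> jeig \<alpha> k / (\<alpha> + 1) * ((\<alpha> + 1) / real N)"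
    using l assms(1) by (intro mult_left_mono) auto
  ultimately have "\<bar>?R m - ?R t\<bar> \<le> jeig \<alpha> k / (\<alpha> + 1) * ((\<alpha> + 1) / real N)"
    by (rule order_trans)
  also have "\<dots> = jeig \<alpha> k / real N" using assms(1) by simp
  finally have "\<bar>?R m - ?R t\<bar> \<le> jeig \<alpha> k / real N" .
  with 1 have "\<bar>\<mu> * q - ?R t\<bar> \<le> 2 * jeig \<alpha> k / real N + jeig \<alpha> k / real N" by linarith
  then show "\<bar>\<mu> * q - ?R t\<bar> \<le> 3 * jeig \<alpha> k / real N" by simp
qed

text \<open>
  The last estimate says \<open>k\<^sup>2 = O(N)\<close>.  This makes the bound in \<open>durrmeyer_eig_lower\<close>
  independent of \<open>N\<close>.
\<close>

lemma n_bound_consequences: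
  assumes "\<alpha> \<ge> 0" "N \<ge> 1" "real k \<le> n_bound \<alpha> N"
  shows "2 * k \<le> N + 2" "k \<le> N" "jeig \<alpha> k \<le> (3 * \<alpha> + 4) * real N"
proof -
  define S where "S = (2 * \<alpha> + 1) * (2 * \<alpha> + 2 * real N + 1)"
  have S0: "S \<ge> 0" using assms(1) by (simp add: S_def)
  have N: "real N \<ge> 1" using assms(2) by simp
  have kS: "2 * real k - 1 + 2 * \<alpha> \<le> sqrt S" using assms(3) by (simp add: n_bound_def S_def)
  have "S \<le> (2 * \<alpha> + 1 + real N)\<^sup>2" by (simp add: S_def power2_eq_square algebra_simps)
  then have "sqrt S \<le> 2 * \<alpha> + 1 + real N" using assms(1) N by (intro real_le_lsqrt) auto
  with kS have k: "2 * real k \<le> real N + 2" by linarith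
  then show k': "2 * k \<le> N + 2" by linarith
  then show "k \<le> N" using assms(2) by linarith
  show "jeig \<alpha> k \<le> (3 * \<alpha> + 4) * real N"
  proof (cases "k = 0")
    case True
    then show ?thesis using assms(1) by (simp add: jeig_def)
  next
    case False
    then have "0 \<le> 2 * real k - 1 + 2 * \<alpha>" using assms(1) by linarith
    then have "(2 * real k - 1 + 2 * \<alpha>)\<^sup>2 \<le> S"
      using kS S0 by (metis abs_of_nonneg real_sqrt_abs real_sqrt_le_iff)
    then have "4 * jeig \<alpha> k \<le> 8 * \<alpha> + real N * (4 * \<alpha> + 2) + 8 * real k"
      by (simp add: S_def jeig_def power2_eq_square algebra_simps)
    also have "\<dots> \<le> 8 * \<alpha> * real N + real N * (4 * \<alpha> + 2) + 4 * (real N + 2 * real N)"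
      using k N assms(1) mult_left_mono[OF N, of "8 * \<alpha>"] by simp
    also have "\<dots> \<le> 4 * ((3 * \<alpha> + 4) * real N)" by (simp add: algebra_simps)
    finally show ?thesis by simp
  qed
qed

lemma hahn_Q_jac_distance:
  assumes "\<alpha> \<ge> 0" "N \<ge> 1" "real k \<le> n_bound \<alpha> N" "0 \<le> t" "t \<le> 1"
  shows "\<bar>hahn_Q \<alpha> \<alpha> N k (real N * t) - poly (jac \<alpha> k) t\<bar>
           \<le> 4 * exp (6 * \<alpha> + 8) * jeig \<alpha> k / real N"
proof -
  define \<mu> where "\<mu> = durrmeyer_eig \<alpha> N k"
  define q where "q = hahn_Q \<alpha> \<alpha> N k (real N * t)"
  define K where "K = exp (6 * \<alpha> + 8)"
  note nb = n_bound_consequences[OF assms(1-3)]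
  have N0: "real N > 0" using assms by simp
  have K: "K \<ge> 1" using assms(1) by (simp add: K_def)
  have l: "jeig \<alpha> k / real N \<ge> 0" using jeig_nonneg[OF assms(1), of k] by simp
  have \<mu>: "0 < \<mu>" "1 - \<mu> \<le> jeig \<alpha> k / real N" "\<mu> \<le> 1"
    unfolding \<mu>_def using durrmeyer_eig_bounds[OF assms(1) nb(2)] by auto
  have "2 * jeig \<alpha> k / real N \<le> 6 * \<alpha> + 8"
    using nb(3) N0 by (simp add: pos_divide_le_eq algebra_simps)
  then have "exp (- (6 * \<alpha> + 8)) \<le> exp (- (2 * jeig \<alpha> k / real N))" by simp
  also have "\<dots> \<le> \<mu>" unfolding \<mu>_def by (rule durrmeyer_eig_lower[OF assms(1) nb(1) assms(2)])
  finally have "1 \<le> K * \<mu>" unfolding K_def exp_minus by (simp add: field_simps)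
  note q = abs_hahn_Q_scaled_le[OF assms(1) nb(2) assms(4,5,2), folded \<mu>_def q_def]
  have "\<bar>q\<bar> * 1 \<le> \<bar>q\<bar> * (K * \<mu>)" using \<open>1 \<le> K * \<mu>\<close> by (intro mult_left_mono) auto
  also have "\<dots> = K * (\<mu> * \<bar>q\<bar>)" by simp
  also have "\<dots> \<le> K * 1" using q(1) K by (intro mult_left_mono) auto
  finally have qK: "\<bar>q\<bar> \<le> K" by simp
  have "\<bar>(1 - \<mu>) * q\<bar> \<le> (jeig \<alpha> k / real N) * K"
    unfolding abs_mult using \<mu> qK l by (intro mult_mono) auto
  moreover have "q - poly (jac \<alpha> k) t = (1 - \<mu>) * q + (\<mu> * q - poly (jac \<alpha> k) t)" by (simp add: algebra_simps)
  moreover have "3 * (jeig \<alpha> k / real N) \<le> K * (3 * (jeig \<alpha> k / real N))"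
    using K l mult_right_mono[OF K, of "3 * (jeig \<alpha> k / real N)"] by simp
  ultimately have "\<bar>q - poly (jac \<alpha> k) t\<bar> \<le> (jeig \<alpha> k / real N) * K + K * (3 * (jeig \<alpha> k / real N))"
    using q(2) by linarith
  then show ?thesis by (simp add: q_def K_def algebra_simps)
qed

section \<open>The norm of the Jacobi polynomials\<close>

text \<open>
  The case distinction makes the weight continuous on \<open>[0,1]\<close>: for \<open>\<alpha> = 0\<close> the powers would vanish at the
  endpoints.
\<close>

definition sym_weight :: "real \<Rightarrow> real \<Rightarrow> real" where
  "sym_weight \<alpha> t = (if \<alpha> = 0 then 1 else t powr \<alpha> * (1 - t) powr \<alpha>)"

lemma sym_weight_eq_beta_kernel:
  "0 < t \<Longrightarrow> t < 1 \<Longrightarrow> sym_weight \<alpha> t = beta_kernel (\<alpha> + 1) (\<alpha> + 1) t"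
  by (simp add: sym_weight_def beta_kernel_def)

lemma continuous_on_sym_weight:
  assumes "\<alpha> \<ge> 0"
  shows "continuous_on {0..1} (sym_weight \<alpha>)"
proof (cases "\<alpha> = 0")
  case True
  then show ?thesis by (simp add: sym_weight_def[abs_def])
next
  case False
  then have "continuous_on {0..1} (\<lambda>t::real. t powr \<alpha> * (1 - t) powr \<alpha>)"
    using assms by (intro continuous_intros continuous_on_powr') auto
  then show ?thesis using False by (simp add: sym_weight_def[abs_def])
qed

lemma sym_weight_nonneg: "0 \<le> sym_weight \<alpha> t"
  by (simp add: sym_weight_def)

lemma sym_weight_le_1:
  assumes "\<alpha> \<ge> 0" "0 \<le> t" "t \<le> 1"
  shows "sym_weight \<alpha> t \<le> 1"
  using assms by (auto simp: sym_weight_def intro!: mult_le_one powr_le1)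

lemma sym_weight_plus1:
  assumes "\<alpha> \<ge> 0" "0 \<le> t" "t \<le> 1"
  shows "sym_weight (\<alpha> + 1) t = t * (1 - t) * sym_weight \<alpha> t"
  using assms by (cases "t = 0 \<or> t = 1") (auto simp: sym_weight_def powr_add)

lemma DERIV_sym_weight:
  assumes "0 < t" "t < 1"
  shows "(sym_weight \<alpha> has_real_derivative \<alpha> * (1 - 2 * t) * sym_weight \<alpha> t / (t * (1 - t))) (at t)"
proof (cases "\<alpha> = 0")
  case True
  then show ?thesis by (simp add: sym_weight_def[abs_def])
next
  case False
  have "((\<lambda>t::real. t powr \<alpha> * (1 - t) powr \<alpha>) has_real_derivative
      \<alpha> * t powr (\<alpha> - 1) * (1 - t) powr \<alpha> + - (\<alpha> * (1 - t) powr (\<alpha> - 1)) * t powr \<alpha>) (at t)"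
    using assms by (auto intro!: derivative_eq_intros simp: powr_diff)
  moreover have "\<alpha> * t powr (\<alpha> - 1) * (1 - t) powr \<alpha> + - (\<alpha> * (1 - t) powr (\<alpha> - 1)) * t powr \<alpha>
     = \<alpha> * (1 - 2 * t) * (t powr \<alpha> * (1 - t) powr \<alpha>) / (t * (1 - t))"
    using assms by (simp add: powr_diff field_simps)
  ultimately show ?thesis using False by (simp add: sym_weight_def[abs_def])
qed

definition jac_norm :: "real \<Rightarrow> nat \<Rightarrow> real" where
  "jac_norm \<alpha> k = integral {0..1} (\<lambda>t. (poly (jac \<alpha> k) t)\<^sup>2 * sym_weight \<alpha> t)"

lemma has_integral_jac_norm:
  assumes "\<alpha> \<ge> 0"
  shows "((\<lambda>t. (poly (jac \<alpha> k) t)\<^sup>2 * sym_weight \<alpha> t) has_integral jac_norm \<alpha> k) {0..1}"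
  unfolding jac_norm_def
  by (intro integrable_integral integrable_continuous_real continuous_intros continuous_on_sym_weight assms)

text \<open>
  Integrating \<open>(w\<^sub>\<alpha>\<^sub>+\<^sub>1 R R')' = w\<^sub>\<alpha>\<^sub>+\<^sub>1 (R')\<^sup>2 - jeig w\<^sub>\<alpha> R\<^sup>2\<close>, where the left side contributes nothing, and
  expressing \<open>R'\<close> by the polynomial with parameter \<open>\<alpha> + 1\<close>.
\<close>

lemma jac_norm_Suc:
  assumes "\<alpha> \<ge> 0"
  shows "jac_norm \<alpha> (Suc k) = jeig \<alpha> (Suc k) / (\<alpha> + 1)\<^sup>2 * jac_norm (\<alpha> + 1) k"
proof -
  define lam where "lam = jeig \<alpha> (Suc k)"
  define R where "R = poly (jac \<alpha> (Suc k))"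
  define R' where "R' = poly (pderiv (jac \<alpha> (Suc k)))"
  define R'' where "R'' = poly (pderiv (pderiv (jac \<alpha> (Suc k))))"
  have lam: "lam > 0" using assms by (simp add: lam_def jeig_def add_pos_nonneg)
  have dR: "(R has_real_derivative R' s) (at s)" "(R' has_real_derivative R'' s) (at s)" for s
    unfolding R_def R'_def R''_def by (rule poly_DERIV)+
  define F where "F = (\<lambda>t. sym_weight (\<alpha> + 1) t * (R t * R' t))"
  have ftc: "((\<lambda>t. (R' t)\<^sup>2 * sym_weight (\<alpha> + 1) t - lam * ((R t)\<^sup>2 * sym_weight \<alpha> t)) has_integral (F 1 - F 0)) {0..1}"
  proof (rule fundamental_theorem_of_calculus_interior)
    show "continuous_on {0..1} F"
      unfolding F_def R_def R'_def using assms by (intro continuous_intros continuous_on_sym_weight) auto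
  next
    fix t :: real assume "t \<in> {0<..<1}"
    then have t: "0 < t" "t < 1" by auto
    have w: "sym_weight (\<alpha> + 1) t = t * (1 - t) * sym_weight \<alpha> t"
      using t assms by (intro sym_weight_plus1) auto
    have ode: "t * (1 - t) * R'' t = - ((\<alpha> + 1) * (1 - 2 * t) * R' t) - lam * R t"
      unfolding R_def R'_def R''_def lam_def by (rule jac_ode[OF assms(1)])
    have "(F has_real_derivative (\<alpha> + 1) * (1 - 2 * t) * sym_weight (\<alpha> + 1) t / (t * (1 - t)) * (R t * R' t)
        + (R' t * R' t + R'' t * R t) * sym_weight (\<alpha> + 1) t) (at t)"
      unfolding F_def by (intro DERIV_mult DERIV_sym_weight dR t)
    also have "(\<alpha> + 1) * (1 - 2 * t) * sym_weight (\<alpha> + 1) t / (t * (1 - t)) * (R t * R' t)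
        + (R' t * R' t + R'' t * R t) * sym_weight (\<alpha> + 1) t
      = sym_weight \<alpha> t * ((\<alpha> + 1) * (1 - 2 * t) * (R t * R' t) + t * (1 - t) * (R' t)\<^sup>2 + (t * (1 - t) * R'' t) * R t)"
    proof -
      have "(\<alpha> + 1) * (1 - 2 * t) * sym_weight (\<alpha> + 1) t / (t * (1 - t)) = (\<alpha> + 1) * (1 - 2 * t) * sym_weight \<alpha> t"
        unfolding w using t by simp
      then show ?thesis by (simp only: w) (simp add: power2_eq_square algebra_simps)
    qed
    also have "\<dots> = (R' t)\<^sup>2 * sym_weight (\<alpha> + 1) t - lam * ((R t)\<^sup>2 * sym_weight \<alpha> t)"
      unfolding ode w by (simp add: power2_eq_square algebra_simps)
    finally show "(F has_vector_derivative (R' t)\<^sup>2 * sym_weight (\<alpha> + 1) t - lam * ((R t)\<^sup>2 * sym_weight \<alpha> t)) (at t)"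
      by (simp add: has_real_derivative_iff_has_vector_derivative)
  qed simp
  have F01: "F 1 - F 0 = 0"
    using assms by (simp add: F_def sym_weight_def)
  have norms: "((\<lambda>t. (R' t)\<^sup>2 * sym_weight (\<alpha> + 1) t - lam * ((R t)\<^sup>2 * sym_weight \<alpha> t)) has_integral
      (lam / (\<alpha> + 1))\<^sup>2 * jac_norm (\<alpha> + 1) k - lam * jac_norm \<alpha> (Suc k)) {0..1}"
  proof (intro has_integral_diff has_integral_mult_right)
    have sq: "(R' t)\<^sup>2 = (lam / (\<alpha> + 1))\<^sup>2 * (poly (jac (\<alpha> + 1) k) t)\<^sup>2" for t
      by (simp only: R'_def pderiv_jac poly_smult power_mult_distrib power2_minus lam_def)
    have "((\<lambda>t. (lam / (\<alpha> + 1))\<^sup>2 * ((poly (jac (\<alpha> + 1) k) t)\<^sup>2 * sym_weight (\<alpha> + 1) t)) has_integral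
        (lam / (\<alpha> + 1))\<^sup>2 * jac_norm (\<alpha> + 1) k) {0..1}"
      using assms by (intro has_integral_mult_right has_integral_jac_norm) auto
    then show "((\<lambda>t. (R' t)\<^sup>2 * sym_weight (\<alpha> + 1) t) has_integral (lam / (\<alpha> + 1))\<^sup>2 * jac_norm (\<alpha> + 1) k) {0..1}"
      by (simp only: sq mult.assoc)
  qed (use has_integral_jac_norm[OF assms(1), of "Suc k"] in \<open>simp add: R_def\<close>)
  have "(lam / (\<alpha> + 1))\<^sup>2 * jac_norm (\<alpha> + 1) k - lam * jac_norm \<alpha> (Suc k) = 0"
    using has_integral_unique[OF norms ftc] unfolding F01 .
  then have "lam * jac_norm \<alpha> (Suc k) = lam * (lam / (\<alpha> + 1)\<^sup>2 * jac_norm (\<alpha> + 1) k)"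
    by (simp add: power_divide power2_eq_square)
  then have "jac_norm \<alpha> (Suc k) = lam / (\<alpha> + 1)\<^sup>2 * jac_norm (\<alpha> + 1) k"
    using lam by (simp only: mult_cancel_left) simp
  then show ?thesis by (simp only: lam_def)
qed

text \<open>
  The recursion trades degree for parameter, so that after \<open>k\<close> steps only a Beta integral is left.
\<close>

lemma jac_norm_closed_form:
  assumes "\<alpha> \<ge> 0"
  shows "jac_norm \<alpha> k = fact k * (Gamma (\<alpha> + 1))\<^sup>2 / (Gamma (real k + 2 * \<alpha> + 1) * (2 * real k + 2 * \<alpha> + 1))"
  using assms
proof (induction k arbitrary: \<alpha>)
  case 0
  have "((\<lambda>t. beta_kernel (\<alpha> + 1) (\<alpha> + 1) t) has_integral Beta (\<alpha> + 1) (\<alpha> + 1)) {0..1}"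
    using has_integral_power_beta_kernel[of "\<alpha> + 1" "\<alpha> + 1" 0] 0 by simp
  then have "((\<lambda>t. (poly (jac \<alpha> 0) t)\<^sup>2 * sym_weight \<alpha> t) has_integral Beta (\<alpha> + 1) (\<alpha> + 1)) {0..1}"
    by (rule has_integral_spike_finite[of "{0, 1}", rotated 2]) (auto simp: sym_weight_eq_beta_kernel)
  then have "jac_norm \<alpha> 0 = Beta (\<alpha> + 1) (\<alpha> + 1)" unfolding jac_norm_def by (rule integral_unique)
  moreover have "Gamma (2 * \<alpha> + 1 + 1) = (2 * \<alpha> + 1) * Gamma (2 * \<alpha> + 1)"
    using 0 by (intro Gamma_plus1) (auto elim!: nonpos_Ints_cases)
  ultimately show ?case by (simp add: Beta_def power2_eq_square algebra_simps)
next
  case (Suc k)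
  have G1: "Gamma (\<alpha> + 1 + 1) = (\<alpha> + 1) * Gamma (\<alpha> + 1)"
    using Suc.prems by (intro Gamma_plus1) (auto elim!: nonpos_Ints_cases)
  have G2: "Gamma (real (Suc k) + 2 * \<alpha> + 1 + 1) = (real (Suc k) + 2 * \<alpha> + 1) * Gamma (real (Suc k) + 2 * \<alpha> + 1)"
    using Suc.prems by (intro Gamma_plus1) (auto elim!: nonpos_Ints_cases)
  have e: "real k + 2 * (\<alpha> + 1) + 1 = real (Suc k) + 2 * \<alpha> + 1 + 1"
    "2 * real k + 2 * (\<alpha> + 1) + 1 = 2 * real (Suc k) + 2 * \<alpha> + 1" by simp_all
  have gen: "(K * L) / A\<^sup>2 * (f * (A * G)\<^sup>2 / ((L * H) * D)) = (K * f) * G\<^sup>2 / (H * D)"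
    if "L \<noteq> 0" "A \<noteq> 0" for K L A f G H D :: real
    using that by (simp add: power_mult_distrib mult_ac)
  have "jac_norm (\<alpha> + 1) k = fact k * (Gamma (\<alpha> + 1 + 1))\<^sup>2 /
      (Gamma (real k + 2 * (\<alpha> + 1) + 1) * (2 * real k + 2 * (\<alpha> + 1) + 1))"
    using Suc.prems by (intro Suc.IH) auto
  then show ?case
    unfolding jac_norm_Suc[OF Suc.prems] e G1 G2 jeig_def fact_Suc
    by (simp only:) (rule gen, use Suc.prems in auto)
qed

lemma jac_norm_pos: "\<alpha> \<ge> 0 \<Longrightarrow> jac_norm \<alpha> k > 0"
  unfolding jac_norm_closed_form by (intro divide_pos_pos mult_pos_pos zero_less_power) auto

text \<open>
  The Gamma quotient in the closed form is a Gauss product for \<open>1 / Gamma (2 \<alpha> + 1)\<close>, which converges and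
  is therefore bounded.
\<close>

lemma inverse_jac_norm_le:
  assumes "\<alpha> \<ge> 0"
  shows "\<exists>C>0. \<forall>k\<ge>1. 1 / jac_norm \<alpha> k \<le> C * real k powr (2 * \<alpha> + 1)"
proof -
  define z where "z = 2 * \<alpha> + 1"
  have z: "z > 0" using assms by (simp add: z_def)
  have "Bseq (rGamma_series z)"
    by (rule convergent_imp_Bseq[OF convergentI[OF rGamma_series_LIMSEQ]])
  then obtain B where B: "B > 0" "\<And>n. norm (rGamma_series z n) \<le> B"
    by (auto elim: BseqE)
  define C where "C = 2 * Gamma z * B / (Gamma (\<alpha> + 1))\<^sup>2"
  have G: "Gamma z > 0" "Gamma (\<alpha> + 1) > 0" using z assms by auto
  have "1 / jac_norm \<alpha> k \<le> C * real k powr z" if k: "k \<ge> 1" for k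
  proof -
    have "pochhammer z (k + 1) = Gamma (z + real k + 1) / Gamma z"
      using z by (subst pochhammer_Gamma) (auto elim!: nonpos_Ints_cases simp: add_ac)
    also have "Gamma (z + real k + 1) = (z + real k) * Gamma (z + real k)"
      using z by (intro Gamma_plus1) (auto elim!: nonpos_Ints_cases)
    finally have po: "(z + real k) * Gamma (z + real k) = Gamma z * pochhammer z (k + 1)" using G by simp
    have "rGamma_series z k = pochhammer z (k + 1) / (fact k * real k powr z)"
      using k by (simp add: rGamma_series_def powr_def)
    moreover have "rGamma_series z k \<le> B" using B(2)[of k] by simp
    moreover have "fact k * real k powr z > 0" using k by simp
    ultimately have "pochhammer z (k + 1) \<le> B * (fact k * real k powr z)" by (simp add: pos_divide_le_eq)
    then have "Gamma z * pochhammer z (k + 1) \<le> Gamma z * (B * (fact k * real k powr z))"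
      using G by (intro mult_left_mono) auto
    then have le: "(z + real k) * Gamma (z + real k) \<le> Gamma z * (B * (fact k * real k powr z))"
      by (simp only: po)
    have "1 / jac_norm \<alpha> k = Gamma (z + real k) * (2 * real k + z) / (fact k * (Gamma (\<alpha> + 1))\<^sup>2)"
      unfolding jac_norm_closed_form[OF assms(1)] z_def by (simp add: add_ac)
    also have "\<dots> \<le> Gamma (z + real k) * (2 * (z + real k)) / (fact k * (Gamma (\<alpha> + 1))\<^sup>2)"
      using z by (intro divide_right_mono mult_left_mono) auto
    also have "\<dots> = 2 * ((z + real k) * Gamma (z + real k)) / (fact k * (Gamma (\<alpha> + 1))\<^sup>2)"
      by simp
    also have "\<dots> \<le> 2 * (Gamma z * (B * (fact k * real k powr z))) / (fact k * (Gamma (\<alpha> + 1))\<^sup>2)"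
      using le by (intro divide_right_mono mult_left_mono) auto
    also have "\<dots> = C * real k powr z" by (simp add: C_def)
    finally show ?thesis .
  qed
  moreover have "C > 0" using G B by (simp add: C_def)
  ultimately show ?thesis unfolding z_def by blast
qed

section \<open>Bernstein operators on functions of bounded variation\<close>

definition bernstein_op :: "nat \<Rightarrow> (real \<Rightarrow> real) \<Rightarrow> real \<Rightarrow> real" where
  "bernstein_op N v t = (\<Sum>i\<le>N. v (real i / real N) * Bernstein N i t)"

lemma DERIV_Bernstein_0:
  "(Bernstein (Suc n) 0 has_real_derivative - (real (Suc n) * Bernstein n 0 t)) (at t)"
  unfolding Bernstein_def[abs_def]
  by (rule derivative_eq_intros refl | simp)+

lemma DERIV_Bernstein_Suc:
  assumes "i \<le> n"
  shows "(Bernstein (Suc n) (Suc i) has_real_derivative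
           real (Suc n) * (Bernstein n i t - Bernstein n (Suc i) t)) (at t)"
proof -
  define c where "c = real (Suc n choose Suc i)"
  have c1: "c * real (Suc i) = real (Suc n) * real (n choose i)"
    unfolding c_def by (metis Suc_times_binomial_eq of_nat_mult mult.commute)
  have c2: "c * real (n - i) = real (Suc n) * real (n choose Suc i)"
  proof -
    have "(Suc n - Suc i) * (Suc n choose Suc i) = Suc n * (n choose Suc i)"
      using binomial_absorb_comp[of "Suc n" "Suc i"] by simp
    then show ?thesis unfolding c_def by (metis diff_Suc_Suc mult.commute of_nat_mult)
  qed
  have "(Bernstein (Suc n) (Suc i) has_real_derivative
     c * (real (Suc i) * t ^ i) * (1 - t) ^ (n - i)
     - c * t ^ Suc i * (real (n - i) * (1 - t) ^ (n - i - 1))) (at t)"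
    unfolding Bernstein_def[abs_def] c_def[symmetric]
    by (rule derivative_eq_intros refl | simp)+
  also have "c * (real (Suc i) * t ^ i) * (1 - t) ^ (n - i)
     - c * t ^ Suc i * (real (n - i) * (1 - t) ^ (n - i - 1))
     = (c * real (Suc i)) * (t ^ i * (1 - t) ^ (n - i))
        - (c * real (n - i)) * (t ^ Suc i * (1 - t) ^ (n - Suc i))" by simp
  also have "\<dots> = real (Suc n) * (Bernstein n i t - Bernstein n (Suc i) t)"
    unfolding c1 c2 by (simp add: Bernstein_def algebra_simps)
  finally show ?thesis .
qed

text \<open>
  Summation by parts leaves only increments of \<open>v\<close>, which bounded variation controls.
\<close>

lemma DERIV_bernstein_op:
  "(bernstein_op (Suc n) v has_real_derivative
     (\<Sum>i\<le>n. (v (real (Suc i) / real (Suc n)) - v (real i / real (Suc n))) * (real (Suc n) * Bernstein n i t))) (at t)"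
proof -
  define c where "c = (\<lambda>i. v (real i / real (Suc n)))"
  have z: "Bernstein n (Suc n) t = 0" by (simp add: Bernstein_def)
  have "((\<lambda>t. c 0 * Bernstein (Suc n) 0 t + (\<Sum>i\<le>n. c (Suc i) * Bernstein (Suc n) (Suc i) t)) has_real_derivative
     c 0 * - (real (Suc n) * Bernstein n 0 t)
     + (\<Sum>i\<le>n. c (Suc i) * (real (Suc n) * (Bernstein n i t - Bernstein n (Suc i) t)))) (at t)"
    by (intro DERIV_add DERIV_cmult DERIV_sum DERIV_Bernstein_0 DERIV_Bernstein_Suc) auto
  moreover have "(\<lambda>t. c 0 * Bernstein (Suc n) 0 t + (\<Sum>i\<le>n. c (Suc i) * Bernstein (Suc n) (Suc i) t)) = bernstein_op (Suc n) v"
    unfolding bernstein_op_def c_def by (subst sum.atMost_Suc_shift) simp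
  moreover have "c 0 * - (real (Suc n) * Bernstein n 0 t)
     + (\<Sum>i\<le>n. c (Suc i) * (real (Suc n) * (Bernstein n i t - Bernstein n (Suc i) t)))
    = (\<Sum>i\<le>n. (c (Suc i) - c i) * (real (Suc n) * Bernstein n i t))"
  proof -
    have "c 0 * Bernstein n 0 t + (\<Sum>i\<le>n. c (Suc i) * Bernstein n (Suc i) t) = (\<Sum>i\<le>Suc n. c i * Bernstein n i t)"
      by (subst sum.atMost_Suc_shift) simp
    also have "\<dots> = (\<Sum>i\<le>n. c i * Bernstein n i t)" by (simp add: z)
    finally have e: "(\<Sum>i\<le>n. c (Suc i) * Bernstein n (Suc i) t) = (\<Sum>i\<le>n. c i * Bernstein n i t) - c 0 * Bernstein n 0 t"
      by simp
    have "(\<Sum>i\<le>n. c (Suc i) * (real (Suc n) * (Bernstein n i t - Bernstein n (Suc i) t)))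
       = real (Suc n) * ((\<Sum>i\<le>n. c (Suc i) * Bernstein n i t) - (\<Sum>i\<le>n. c (Suc i) * Bernstein n (Suc i) t))"
      unfolding sum_subtractf[symmetric] sum_distrib_left by (intro sum.cong) (auto simp: algebra_simps)
    moreover have "(\<Sum>i\<le>n. (c (Suc i) - c i) * (real (Suc n) * Bernstein n i t))
       = real (Suc n) * ((\<Sum>i\<le>n. c (Suc i) * Bernstein n i t) - (\<Sum>i\<le>n. c i * Bernstein n i t))"
      unfolding sum_subtractf[symmetric] sum_distrib_left by (intro sum.cong) (auto simp: algebra_simps)
    ultimately show ?thesis unfolding e by (simp add: algebra_simps)
  qed
  ultimately show ?thesis by (simp add: c_def)
qed

lemma bernstein_op_1: "N \<ge> 1 \<Longrightarrow> bernstein_op N v 1 = v 1"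
proof -
  assume N: "N \<ge> 1"
  have "bernstein_op N v 1 = (\<Sum>i\<le>N. if i = N then v 1 else 0)"
    unfolding bernstein_op_def using N
    by (intro sum.cong) (auto simp: Bernstein_def power_0_left)
  then show ?thesis by simp
qed

lemma Bernstein_eq_beta_kernel:
  assumes "i \<le> n" "0 < t" "t < 1"
  shows "real (Suc n) * Bernstein n i t * Beta (real i + 1) (real (n - i) + 1)
       = beta_kernel (real i + 1) (real (n - i) + 1) t"
proof -
  have B: "Beta (real i + 1) (real (n - i) + 1) = fact i * fact (n - i) / fact (Suc n)"
  proof -
    have "real i + 1 + (real (n - i) + 1) = 1 + real (Suc n)" using assms by (simp add: of_nat_diff)
    then show ?thesis unfolding Beta_def
      using Gamma_fact[of i, where ?'a = real] Gamma_fact[of "n - i", where ?'a = real]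
        Gamma_fact[of "Suc n", where ?'a = real] by (simp only: add.commute)
  qed
  have "t powr (real i + 1 - 1) = t ^ i" "(1 - t) powr (real (n - i) + 1 - 1) = (1 - t) ^ (n - i)"
    using assms by (simp_all add: powr_realpow del: of_nat_diff)
  then show ?thesis unfolding B beta_kernel_def
    using assms(1) by (simp add: Bernstein_def binomial_fact del: of_nat_diff)
qed

text \<open>
  The grid points and one intermediate point per cell form a single increasing sequence.
\<close>

lemma total_variation_samples:
  fixes v :: "real \<Rightarrow> real"
  assumes V: "\<And>m t. mono_on {..m} t \<Longrightarrow> t ` {..m} \<subseteq> {0..1} \<Longrightarrow> (\<Sum>i<m. \<bar>v (t (Suc i)) - v (t i)\<bar>) \<le> V"
    and \<xi>: "\<And>i. i < N \<Longrightarrow> \<xi> i \<in> {real i / real N..real (Suc i) / real N}"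
  shows "(\<Sum>i<N. \<bar>v (\<xi> i) - v (real i / real N)\<bar> + \<bar>v (real (Suc i) / real N) - v (\<xi> i)\<bar>) \<le> V"
proof -
  \<comment> \<open>Beyond the grid the default value keeps \<open>t\<close> monotone on all of \<open>nat\<close>.\<close>
  define \<zeta> where "\<zeta> i = (if i < N then \<xi> i else real i / real N)" for i
  define t where "t j = (if even j then real (j div 2) / real N else \<zeta> (j div 2))" for j
  have \<zeta>: "real i / real N \<le> \<zeta> i" "\<zeta> i \<le> real (Suc i) / real N" for i
    using \<xi>[of i] by (auto simp: \<zeta>_def intro!: divide_right_mono)
  have t2: "t (2 * i) = real i / real N" "t (Suc (2 * i)) = \<zeta> i" for i
    by (simp_all add: t_def)
  have "t j \<le> t (Suc j)" for j
  proof (cases "even j")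
    case True
    then obtain i where "j = 2 * i" by (rule evenE)
    then show ?thesis using \<zeta>[of i] by (simp add: t2)
  next
    case False
    then obtain i where j: "j = 2 * i + 1" by (rule oddE)
    then have "Suc j = 2 * Suc i" by simp
    then show ?thesis using \<zeta>[of i] t2(1)[of "Suc i"] t2(2)[of i] j by simp
  qed
  then have mono: "mono t" by (simp add: mono_iff_le_Suc)
  have "t ` {..2 * N} \<subseteq> {0..1}"
  proof
    fix x assume "x \<in> t ` {..2 * N}"
    then obtain j where j: "j \<le> 2 * N" "x = t j" by auto
    have "t 0 \<le> t j" "t j \<le> t (2 * N)" using mono j by (auto dest: monoD)
    moreover have "t 0 = 0" using t2(1)[of 0] by simp
    moreover have "t (2 * N) \<le> 1" using t2(1)[of N] by simp
    ultimately show "x \<in> {0..1}" using j by auto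
  qed
  then have "(\<Sum>j<2 * N. \<bar>v (t (Suc j)) - v (t j)\<bar>) \<le> V"
    using mono by (intro V) (auto simp: mono_on_def dest: monoD)
  moreover have "(\<Sum>j<2 * M. \<bar>v (t (Suc j)) - v (t j)\<bar>)
     = (\<Sum>i<M. \<bar>v (\<zeta> i) - v (real i / real N)\<bar> + \<bar>v (real (Suc i) / real N) - v (\<zeta> i)\<bar>)" for M
  proof (induction M)
    case (Suc M)
    have "Suc (Suc (2 * M)) = 2 * Suc M" by simp
    then have "t (Suc (Suc (2 * M))) = real (Suc M) / real N" using t2(1)[of "Suc M"] by simp
    moreover have "{..<2 * Suc M} = insert (Suc (2 * M)) (insert (2 * M) {..<2 * M})" by auto
    ultimately show ?case using Suc.IH by (simp add: t2 del: of_nat_Suc mult_Suc_right)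
  qed simp
  ultimately show ?thesis by (simp add: \<zeta>_def)
qed

lemma integral_telescope:
  fixes f :: "real \<Rightarrow> real"
  assumes "continuous_on {0..1} f" "j \<le> N"
  shows "integral {0..real j / real N} f = (\<Sum>i<j. integral {real i / real N..real (Suc i) / real N} f)"
  using assms(2)
proof (induction j)
  case (Suc j)
  have le: "real j / real N \<le> real (Suc j) / real N" "real (Suc j) / real N \<le> 1"
    using Suc.prems by (auto intro: divide_right_mono simp del: of_nat_Suc simp: divide_le_eq_1)
  have int: "f integrable_on {0..real (Suc j) / real N}"
    using le by (intro integrable_continuous_real continuous_on_subset[OF assms(1)]) auto
  have "integral {0..real j / real N} f + integral {real j / real N..real (Suc j) / real N} f
      = integral {0..real (Suc j) / real N} f"
    by (rule Henstock_Kurzweil_Integration.integral_combine[OF _ le(1) int]) simp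
  then show ?case using Suc by (simp del: of_nat_Suc)
qed simp

text \<open>
  With \<open>H\<close> the antiderivative of \<open>g\<close>, both integrals are \<open>v 1 * H 1\<close> minus a sum of increments of \<open>v\<close>:
  for \<open>bernstein_op N v\<close> they are weighted by expectations of \<open>H\<close> under Beta distributions with mean
  \<open>(i + 1) / (N + 1)\<close>, for \<open>v\<close> itself by \<open>H((i + 1) / N)\<close>, up to the oscillation of \<open>v\<close> on cells of length \<open>1/N\<close>.
  The expectations contribute \<open>M\<close>, the shift of the mean and the oscillation \<open>K\<close> each.
\<close>

lemma bernstein_functional_error:
  fixes v g g' :: "real \<Rightarrow> real"
  assumes N: "N \<ge> 1"
    and v: "continuous_on {0..1} v"
    and V: "\<And>m t. mono_on {..m} t \<Longrightarrow> t ` {..m} \<subseteq> {0..1} \<Longrightarrow> (\<Sum>i<m. \<bar>v (t (Suc i)) - v (t i)\<bar>) \<le> V"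
    and g: "continuous_on {0..1} g"
    and dg: "\<And>s. 0 < s \<Longrightarrow> s < 1 \<Longrightarrow> (g has_real_derivative g' s) (at s)"
    and K: "\<And>s. 0 \<le> s \<Longrightarrow> s \<le> 1 \<Longrightarrow> \<bar>g s\<bar> \<le> K"
    and M: "\<And>s. 0 < s \<Longrightarrow> s < 1 \<Longrightarrow> s * (1 - s) * \<bar>g' s\<bar> \<le> M"
  shows "\<bar>integral {0..1} (\<lambda>t. bernstein_op N v t * g t) - integral {0..1} (\<lambda>t. v t * g t)\<bar>
           \<le> V * (M + 2 * K) / real N"
proof -
  obtain n where Nn: "N = Suc n" using N by (cases N) auto
  have N0: "real N > 0" using N by simp
  define x where "x i = real i / real N" for i
  have x: "0 \<le> x i" "x i \<le> x (Suc i)" "i < N \<Longrightarrow> x (Suc i) \<le> 1" "x (Suc i) - x i = 1 / real N" for i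
    using N0 by (auto simp: x_def field_simps)
  have K0: "K \<ge> 0" using K[of 0] by simp
  have M0: "M \<ge> 0" using M[of "1/2"] by (simp add: order_trans[OF abs_ge_zero])
  define H where "H t = integral {0..t} g" for t
  have dH: "(H has_real_derivative g t) (at t within {0..1})" if "t \<in> {0..1}" for t
    unfolding H_def by (rule integral_has_real_derivative[OF g that])
  have dH': "(H has_real_derivative g t) (at t)" if "0 < t" "t < 1" for t
    using dH[of t] that by (simp add: at_within_Icc_at)
  have cH: "continuous_on {0..1} H"
    using dH by (meson DERIV_continuous continuous_on_eq_continuous_within)
  have H0: "H 0 = 0" by (simp add: H_def)
  have lipH: "\<bar>H s - H t\<bar> \<le> K * \<bar>s - t\<bar>" if "s \<in> {0..1}" "t \<in> {0..1}" for s t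
    using field_differentiable_bound[of "{0..1}" H g K s t] dH K that by auto
  define D where "D i = v (x (Suc i)) - v (x i)" for i
  \<comment> \<open>Expectation of \<open>H\<close> under the Beta distribution with parameters \<open>i + 1\<close> and \<open>N - i\<close>.\<close>
  define e where "e i = integral {0..1} (\<lambda>t. real N * Bernstein n i t * H t)" for i
  have cB: "continuous_on {0..1} (Bernstein m i)" for m i
    unfolding Bernstein_def[abs_def] by (intro continuous_intros)
  have cBv: "continuous_on {0..1} (bernstein_op N v)"
    unfolding bernstein_op_def[abs_def] by (intro continuous_intros cB)
  have by_parts: "integral {0..1} (\<lambda>t. bernstein_op N v t * g t) = v 1 * H 1 - (\<Sum>i<N. D i * e i)"
  proof -
    have "((\<lambda>t. (\<Sum>i\<le>n. D i * (real N * Bernstein n i t)) * H t + bernstein_op N v t * g t) has_integral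
        (bernstein_op N v 1 * H 1 - bernstein_op N v 0 * H 0)) {0..1}"
    proof (rule fundamental_theorem_of_calculus_interior)
      show "continuous_on {0..1} (\<lambda>t. bernstein_op N v t * H t)" by (intro continuous_intros cBv cH)
    next
      fix t :: real assume "t \<in> {0<..<1}"
      then have t: "0 < t" "t < 1" by auto
      have "((\<lambda>t. bernstein_op N v t * H t) has_real_derivative
         (\<Sum>i\<le>n. D i * (real N * Bernstein n i t)) * H t + g t * bernstein_op N v t) (at t)"
        unfolding Nn D_def x_def by (intro DERIV_mult DERIV_bernstein_op dH' t)
      then show "((\<lambda>t. bernstein_op N v t * H t) has_vector_derivative
         (\<Sum>i\<le>n. D i * (real N * Bernstein n i t)) * H t + bernstein_op N v t * g t) (at t)"
        by (simp add: has_real_derivative_iff_has_vector_derivative mult.commute)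
    qed simp
    then have "integral {0..1} (\<lambda>t. (\<Sum>i\<le>n. D i * (real N * Bernstein n i t)) * H t + bernstein_op N v t * g t)
        = v 1 * H 1"
      using bernstein_op_1[OF N] by (simp add: integral_unique H0)
    moreover have "integral {0..1} (\<lambda>t. (\<Sum>i\<le>n. D i * (real N * Bernstein n i t)) * H t + bernstein_op N v t * g t)
       = integral {0..1} (\<lambda>t. (\<Sum>i\<le>n. D i * (real N * Bernstein n i t)) * H t) + integral {0..1} (\<lambda>t. bernstein_op N v t * g t)"
      by (intro integral_add integrable_continuous_real continuous_intros cB cH cBv g)
    moreover have "integral {0..1} (\<lambda>t. (\<Sum>i\<le>n. D i * (real N * Bernstein n i t)) * H t) = (\<Sum>i\<le>n. D i * e i)"
    proof -
      have "integral {0..1} (\<lambda>t. (\<Sum>i\<le>n. D i * (real N * Bernstein n i t)) * H t)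
        = integral {0..1} (\<lambda>t. \<Sum>i\<le>n. D i * (real N * Bernstein n i t * H t))"
        by (simp add: sum_distrib_right mult.assoc)
      also have "\<dots> = (\<Sum>i\<le>n. integral {0..1} (\<lambda>t. D i * (real N * Bernstein n i t * H t)))"
        by (intro integral_sum integrable_continuous_real continuous_intros cB cH) auto
      finally show ?thesis by (simp add: e_def)
    qed
    moreover have "{..n} = {..<N}" using Nn by auto
    ultimately show ?thesis by simp
  qed
  have e_near: "\<bar>e i - H (x (Suc i))\<bar> \<le> (M + K) / real N" if i: "i < N" for i
  proof -
    let ?a = "real i + 1" and ?b = "real (n - i) + 1"
    have in': "i \<le> n" using i Nn by simp
    have ab: "?a + ?b = real N + 1" using in' Nn by (simp add: of_nat_diff)
    have B: "Beta ?a ?b > 0" by (intro Beta_pos) auto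
    have "((\<lambda>t. real N * Bernstein n i t * H t) has_integral e i) {0..1}"
      unfolding e_def by (intro integrable_integral integrable_continuous_real continuous_intros cB cH)
    then have "((\<lambda>t. real N * Bernstein n i t * H t * Beta ?a ?b) has_integral e i * Beta ?a ?b) {0..1}"
      by (rule has_integral_mult_left)
    then have "((\<lambda>t. H t * beta_kernel ?a ?b t) has_integral e i * Beta ?a ?b) {0..1}"
    proof (rule has_integral_spike_finite[of "{0, 1}", rotated 2])
      fix t :: real assume "t \<in> {0..1} - {0, 1}"
      then have "0 < t" "t < 1" by auto
      from Bernstein_eq_beta_kernel[OF in' this, folded Nn]
      show "H t * beta_kernel ?a ?b t = real N * Bernstein n i t * H t * Beta ?a ?b"
        by (metis mult.assoc mult.commute)
    qed simp
    then have "\<bar>e i * Beta ?a ?b - H (?a / (?a + ?b)) * Beta ?a ?b\<bar> \<le> M * Beta ?a ?b / (?a + ?b + 1)"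
      by (intro beta_expectation_bound[where F' = g and F'' = g'] dH' dg M) auto
    then have "\<bar>e i - H (?a / (?a + ?b))\<bar> * Beta ?a ?b \<le> M / (?a + ?b + 1) * Beta ?a ?b"
      using B by (simp add: abs_mult flip: left_diff_distrib)
    then have "\<bar>e i - H (?a / (?a + ?b))\<bar> \<le> M / (?a + ?b + 1)"
      using B by (simp only: mult_le_cancel_right_pos)
    also have "\<dots> \<le> M / real N"
      unfolding ab using N0 M0 by (intro divide_left_mono) auto
    finally have 1: "\<bar>e i - H (?a / (?a + ?b))\<bar> \<le> M / real N" .
    have xs: "x (Suc i) = ?a / real N" by (simp add: x_def add.commute)
    have le1: "?a / real N \<le> 1" using i N0 by (simp add: field_simps)
    have m: "?a / (?a + ?b) \<in> {0..1}" unfolding ab using i by (simp add: field_simps)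
    have "\<bar>H (?a / (?a + ?b)) - H (x (Suc i))\<bar> \<le> K * \<bar>?a / (?a + ?b) - x (Suc i)\<bar>"
      using m le1 by (intro lipH) (auto simp: xs)
    also have "\<bar>?a / (?a + ?b) - x (Suc i)\<bar> = (?a / real N) / (real N + 1)"
    proof -
      have "p / (real N + 1) - p / real N = - ((p / real N) / (real N + 1))" for p
        using N0 by (simp add: field_simps)
      then show ?thesis unfolding ab xs by simp
    qed
    also have "\<dots> \<le> 1 / real N"
      using le1 N0 by (intro frac_le) auto
    finally have "\<bar>H (?a / (?a + ?b)) - H (x (Suc i))\<bar> \<le> K * (1 / real N)"
      using K0 by (simp add: mult_left_mono)
    with 1 have "\<bar>e i - H (x (Suc i))\<bar> \<le> M / real N + K * (1 / real N)" by linarith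
    then show ?thesis by (simp add: add_divide_distrib)
  qed
  have "\<exists>\<xi>. \<xi> \<in> {x i..x (Suc i)} \<and> (\<forall>s\<in>{x i..x (Suc i)}. \<bar>v s - v (x i)\<bar> \<le> \<bar>v \<xi> - v (x i)\<bar>)" if "i < N" for i
  proof -
    have "continuous_on {x i..x (Suc i)} (\<lambda>s. \<bar>v s - v (x i)\<bar>)"
      by (intro continuous_intros continuous_on_subset[OF v]) (use x[of i] that in auto)
    moreover have "compact {x i..x (Suc i)}" "{x i..x (Suc i)} \<noteq> {}" using x[of i] by auto
    ultimately show ?thesis using continuous_attains_sup by metis
  qed
  then obtain \<xi> where \<xi>: "\<And>i. i < N \<Longrightarrow> \<xi> i \<in> {x i..x (Suc i)}"
    and osc: "\<And>i s. i < N \<Longrightarrow> s \<in> {x i..x (Suc i)} \<Longrightarrow> \<bar>v s - v (x i)\<bar> \<le> \<bar>v (\<xi> i) - v (x i)\<bar>"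
    by metis
  define \<omega> where "\<omega> i = \<bar>v (\<xi> i) - v (x i)\<bar>" for i
  have samples: "(\<Sum>i<N. \<omega> i + \<bar>v (x (Suc i)) - v (\<xi> i)\<bar>) \<le> V"
    unfolding \<omega>_def x_def by (rule total_variation_samples[OF V]) (use \<xi> in \<open>auto simp: x_def\<close>)
  have sumD: "(\<Sum>i<N. \<bar>D i\<bar>) \<le> V"
    by (rule order_trans[OF sum_mono samples]) (auto simp: D_def \<omega>_def)
  have sum\<omega>: "(\<Sum>i<N. \<omega> i) \<le> V"
    by (rule order_trans[OF sum_mono samples]) auto
  \<comment> \<open>Error of freezing \<open>v\<close> at the left end of the \<open>i\<close>-th cell.\<close>
  define r where "r i = integral {x i..x (Suc i)} (\<lambda>t. v t * g t) - v (x i) * (H (x (Suc i)) - H (x i))" for i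
  have r: "\<bar>r i\<bar> \<le> K * \<omega> i / real N" if i: "i < N" for i
  proof -
    have sub: "{x i..x (Suc i)} \<subseteq> {0..1}" using x[of i] i by auto
    have cg: "continuous_on {x i..x (Suc i)} g" and cv: "continuous_on {x i..x (Suc i)} v"
      using g v sub continuous_on_subset by blast+
    have "H (x i) + integral {x i..x (Suc i)} g = H (x (Suc i))"
      unfolding H_def using x[of i] i
      by (intro Henstock_Kurzweil_Integration.integral_combine integrable_continuous_real continuous_on_subset[OF g]) auto
    then have "H (x (Suc i)) - H (x i) = integral {x i..x (Suc i)} g" by simp
    then have "r i = integral {x i..x (Suc i)} (\<lambda>t. v t * g t) - integral {x i..x (Suc i)} (\<lambda>t. v (x i) * g t)"
      by (simp add: r_def)
    also have "\<dots> = integral {x i..x (Suc i)} (\<lambda>t. (v t - v (x i)) * g t)"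
      unfolding left_diff_distrib
      by (intro integral_diff[symmetric] integrable_continuous_real continuous_intros cg cv)
    finally have ri: "r i = integral {x i..x (Suc i)} (\<lambda>t. (v t - v (x i)) * g t)" .
    have "norm (r i) \<le> (\<omega> i * K) * (x (Suc i) - x i)"
      unfolding ri
    proof (rule integral_bound)
      show "continuous_on {x i..x (Suc i)} (\<lambda>t. (v t - v (x i)) * g t)"
        by (intro continuous_intros cg cv)
      fix t assume t: "t \<in> {x i..x (Suc i)}"
      show "norm ((v t - v (x i)) * g t) \<le> \<omega> i * K"
        unfolding real_norm_def abs_mult \<omega>_def
        using osc[OF i t] K[of t] t sub by (intro mult_mono) auto
    qed (use x in auto)
    then show ?thesis by (simp add: x(4) mult.commute)
  qed
  have cells: "integral {0..1} (\<lambda>t. v t * g t) = v 1 * H 1 - (\<Sum>i<N. D i * H (x (Suc i))) + (\<Sum>i<N. r i)"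
  proof -
    have "integral {0..real N / real N} (\<lambda>t. v t * g t) = (\<Sum>i<N. integral {x i..x (Suc i)} (\<lambda>t. v t * g t))"
      unfolding x_def by (rule integral_telescope) (auto intro!: continuous_intros v g)
    then have "integral {0..1} (\<lambda>t. v t * g t) = (\<Sum>i<N. v (x i) * (H (x (Suc i)) - H (x i)) + r i)"
      using N0 by (simp add: r_def)
    also have "\<dots> = (\<Sum>i<N. (v (x (Suc i)) * H (x (Suc i)) - v (x i) * H (x i)) - D i * H (x (Suc i)) + r i)"
      by (intro sum.cong) (auto simp: D_def algebra_simps)
    also have "\<dots> = (\<Sum>i<N. v (x (Suc i)) * H (x (Suc i)) - v (x i) * H (x i))
        - (\<Sum>i<N. D i * H (x (Suc i))) + (\<Sum>i<N. r i)"
      by (simp add: sum.distrib sum_subtractf)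
    also have "(\<Sum>i<N. v (x (Suc i)) * H (x (Suc i)) - v (x i) * H (x i)) = v (x N) * H (x N) - v (x 0) * H (x 0)"
      by (rule sum_lessThan_telescope)
    finally show ?thesis using N0 by (simp add: x_def H0)
  qed
  have "integral {0..1} (\<lambda>t. bernstein_op N v t * g t) - integral {0..1} (\<lambda>t. v t * g t)
     = - (\<Sum>i<N. D i * (e i - H (x (Suc i)))) - (\<Sum>i<N. r i)"
    unfolding by_parts cells by (simp add: right_diff_distrib sum_subtractf)
  then have "\<bar>integral {0..1} (\<lambda>t. bernstein_op N v t * g t) - integral {0..1} (\<lambda>t. v t * g t)\<bar>
     \<le> \<bar>\<Sum>i<N. D i * (e i - H (x (Suc i)))\<bar> + \<bar>\<Sum>i<N. r i\<bar>" by linarith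
  also have "\<bar>\<Sum>i<N. D i * (e i - H (x (Suc i)))\<bar> \<le> (\<Sum>i<N. \<bar>D i\<bar> * ((M + K) / real N))"
    by (rule order_trans[OF sum_abs sum_mono]) (simp only: abs_mult lessThan_iff, intro mult_left_mono e_near abs_ge_zero)
  also have "\<dots> \<le> V * ((M + K) / real N)"
    unfolding sum_distrib_right[symmetric] using sumD M0 K0 by (intro mult_right_mono) auto
  also have "\<bar>\<Sum>i<N. r i\<bar> \<le> (\<Sum>i<N. \<omega> i * (K / real N))"
    by (rule order_trans[OF sum_abs sum_mono]) (use r in \<open>simp add: mult.commute\<close>)
  also have "\<dots> \<le> V * (K / real N)"
    unfolding sum_distrib_right[symmetric] using sum\<omega> K0 by (intro mult_right_mono) auto
  finally show ?thesis by (simp add: algebra_simps add_divide_distrib)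
qed

section \<open>Comparison of the partial sums\<close>

definition jac_coeff :: "real \<Rightarrow> (real \<Rightarrow> real) \<Rightarrow> nat \<Rightarrow> real" where
  "jac_coeff \<alpha> v k =
     integral {0..1} (\<lambda>t. v t * (poly (jac \<alpha> k) t * sym_weight \<alpha> t)) / jac_norm \<alpha> k"

text \<open>
  The factor in front of \<open>jac\<close> cancels in Fourier expansions, the sign \<open>(-1) ^ k\<close> included.
\<close>

lemma jacobi_P_eq_jac:
  assumes "\<alpha> \<ge> 0"
  shows "jacobi_P \<alpha> \<alpha> k (2 * t - 1) = rbinom (real k + \<alpha>) (real k) * (-1) ^ k * poly (jac \<alpha> k) t"
proof -
  have e: "real k + \<alpha> + \<alpha> + 1 = real k + 2 * \<alpha> + 1" "(1 - (2 * t - 1)) / 2 = 1 - t" by simp_all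
  have "jacobi_P \<alpha> \<alpha> k (2 * t - 1) = rbinom (real k + \<alpha>) (real k) * poly (jac \<alpha> k) (1 - t)"
    unfolding jacobi_P_def poly_jac jcoeff_def e ..
  then show ?thesis by (simp add: poly_jac_reflect[OF assms])
qed

lemma jacobi_inner_eq:
  assumes \<alpha>: "\<alpha> \<ge> 0" and cont: "continuous_on {0..1} (\<lambda>t. f (2 * t - 1) * g (2 * t - 1))"
  shows "jacobi_inner \<alpha> f g =
    2 * 4 powr \<alpha> * integral {0..1} (\<lambda>t. f (2 * t - 1) * g (2 * t - 1) * sym_weight \<alpha> t)"
proof -
  define F where "F = (\<lambda>x. f x * g x * jacobi_weight \<alpha> x)"
  define I where "I = integral {0..1} (\<lambda>t. f (2 * t - 1) * g (2 * t - 1) * sym_weight \<alpha> t)"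
  have "((\<lambda>t. 4 powr \<alpha> * (f (2 * t - 1) * g (2 * t - 1) * sym_weight \<alpha> t)) has_integral 4 powr \<alpha> * I) {0..1}"
    unfolding I_def
    by (intro has_integral_mult_right integrable_integral integrable_continuous_real
        continuous_on_mult cont continuous_on_sym_weight \<alpha>)
  then have "((\<lambda>t. F (2 * t - 1)) has_integral 4 powr \<alpha> * I) {0..1}"
  proof (rule has_integral_spike_finite[of "{0, 1}", rotated 2])
    fix t :: real assume "t \<in> {0..1} - {0, 1}"
    then have t: "0 < t" "t < 1" by auto
    have "(2 * (1 - t)) powr \<alpha> * (2 * t) powr \<alpha> = 4 powr \<alpha> * (t powr \<alpha> * (1 - t) powr \<alpha>)"
      using t powr_mult[of 2 2 \<alpha>] powr_mult[of 2 "1 - t" \<alpha>] powr_mult[of 2 t \<alpha>] by simp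
    moreover have "1 - (2 * t - 1) = 2 * (1 - t)" "1 + (2 * t - 1) = 2 * t" by simp_all
    ultimately have "jacobi_weight \<alpha> (2 * t - 1) = 4 powr \<alpha> * sym_weight \<alpha> t"
      unfolding jacobi_weight_def sym_weight_def using t by auto
    then show "F (2 * t - 1) = 4 powr \<alpha> * (f (2 * t - 1) * g (2 * t - 1) * sym_weight \<alpha> t)"
      by (simp add: F_def)
  qed simp
  then have "((\<lambda>x. F (2 * ((1 / 2) *\<^sub>R x + 1 / 2) - 1)) has_integral (4 powr \<alpha> * I) /\<^sub>R (1 / 2) ^ DIM(real))
      (cbox ((0 - 1 / 2) /\<^sub>R (1 / 2)) ((1 - 1 / 2) /\<^sub>R (1 / 2)))"
    by (intro has_integral_affinity') auto
  then have "(F has_integral 2 * 4 powr \<alpha> * I) {-1..1}" by (simp add: algebra_simps)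
  then show ?thesis by (simp add: jacobi_inner_def F_def I_def integral_unique)
qed

lemma jacobi_partial_sum_eq:
  assumes \<alpha>: "\<alpha> \<ge> 0" and v: "continuous_on {0..1} (\<lambda>t. u (2 * t - 1))"
  shows "jacobi_partial_sum \<alpha> n u (2 * t - 1) =
    (\<Sum>k\<le>n. jac_coeff \<alpha> (\<lambda>t. u (2 * t - 1)) k * poly (jac \<alpha> k) t)"
  unfolding jacobi_partial_sum_def
proof (intro sum.cong refl)
  fix k
  define c where "c = rbinom (real k + \<alpha>) (real k) * (-1) ^ k"
  have "Gamma (real k + \<alpha> + 1) \<noteq> 0" "Gamma (real k + 1) \<noteq> 0" "Gamma (\<alpha> + 1) \<noteq> 0"
    using \<alpha> by (intro less_imp_neq[symmetric] Gamma_real_pos; simp)+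
  then have c: "c \<noteq> 0" by (simp add: c_def rbinom_def)
  have P: "jacobi_P \<alpha> \<alpha> k (2 * s - 1) = c * poly (jac \<alpha> k) s" for s
    using jacobi_P_eq_jac[OF \<alpha>] by (simp add: c_def)
  have uP: "jacobi_inner \<alpha> u (jacobi_P \<alpha> \<alpha> k) = 2 * 4 powr \<alpha> *
     (c * integral {0..1} (\<lambda>t. u (2 * t - 1) * (poly (jac \<alpha> k) t * sym_weight \<alpha> t)))"
  proof -
    have "jacobi_inner \<alpha> u (jacobi_P \<alpha> \<alpha> k) = 2 * 4 powr \<alpha> *
        integral {0..1} (\<lambda>t. u (2 * t - 1) * jacobi_P \<alpha> \<alpha> k (2 * t - 1) * sym_weight \<alpha> t)"
      by (rule jacobi_inner_eq[OF \<alpha>]) (unfold P, intro continuous_intros v)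
    also have "(\<lambda>t. u (2 * t - 1) * jacobi_P \<alpha> \<alpha> k (2 * t - 1) * sym_weight \<alpha> t)
       = (\<lambda>t. c * (u (2 * t - 1) * (poly (jac \<alpha> k) t * sym_weight \<alpha> t)))"
      unfolding P by (simp add: mult_ac)
    finally show ?thesis by simp
  qed
  have PP: "jacobi_inner \<alpha> (jacobi_P \<alpha> \<alpha> k) (jacobi_P \<alpha> \<alpha> k) = 2 * 4 powr \<alpha> * (c * (c * jac_norm \<alpha> k))"
  proof -
    have "jacobi_inner \<alpha> (jacobi_P \<alpha> \<alpha> k) (jacobi_P \<alpha> \<alpha> k) = 2 * 4 powr \<alpha> *
        integral {0..1} (\<lambda>t. jacobi_P \<alpha> \<alpha> k (2 * t - 1) * jacobi_P \<alpha> \<alpha> k (2 * t - 1) * sym_weight \<alpha> t)"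
      by (rule jacobi_inner_eq[OF \<alpha>]) (unfold P, intro continuous_intros)
    also have "(\<lambda>t. jacobi_P \<alpha> \<alpha> k (2 * t - 1) * jacobi_P \<alpha> \<alpha> k (2 * t - 1) * sym_weight \<alpha> t)
       = (\<lambda>t. c * (c * ((poly (jac \<alpha> k) t)\<^sup>2 * sym_weight \<alpha> t)))"
      unfolding P by (simp add: power2_eq_square mult_ac)
    finally show ?thesis by (simp add: jac_norm_def)
  qed
  show "jacobi_inner \<alpha> u (jacobi_P \<alpha> \<alpha> k) / jacobi_inner \<alpha> (jacobi_P \<alpha> \<alpha> k) (jacobi_P \<alpha> \<alpha> k) *
      jacobi_P \<alpha> \<alpha> k (2 * t - 1) = jac_coeff \<alpha> (\<lambda>t. u (2 * t - 1)) k * poly (jac \<alpha> k) t"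
    unfolding uP PP P jac_coeff_def using c by simp
qed

text \<open>
  The Hahn weight is a multiple of the beta-binomial distribution, that is, of the integral of a Bernstein
  polynomial against \<open>sym_weight\<close>.
\<close>

lemma hahn_weight_eq_Beta:
  assumes "\<alpha> \<ge> 0" "i \<le> N"
  shows "hahn_weight \<alpha> N i = Gamma (real N + 2 * \<alpha> + 2) / (fact N * (Gamma (\<alpha> + 1))\<^sup>2) *
           (real (N choose i) * Beta (real i + \<alpha> + 1) (real N - real i + \<alpha> + 1))"
proof -
  define G where "G = Gamma (real N + 2 * \<alpha> + 2)"
  define A where "A = Gamma (\<alpha> + 1)"
  define X where "X = Gamma (real i + \<alpha> + 1)"
  define Y where "Y = Gamma (real N - real i + \<alpha> + 1)"
  have pos: "G > 0" "A > 0" using assms(1) by (auto simp: G_def A_def)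
  have e: "\<alpha> + real i + 1 = real i + \<alpha> + 1" "\<alpha> + real N - real i + 1 = real N - real i + \<alpha> + 1"
    "\<alpha> + real i - real i + 1 = \<alpha> + 1" "\<alpha> + real N - real i - (real N - real i) + 1 = \<alpha> + 1"
    "real i + \<alpha> + 1 + (real N - real i + \<alpha> + 1) = real N + 2 * \<alpha> + 2"
    "real N - real i + 1 = 1 + real (N - i)" "real i + 1 = 1 + real i"
    using assms(2) by (simp_all add: of_nat_diff)
  have "hahn_weight \<alpha> N i = X / (fact i * A) * (Y / (fact (N - i) * A))"
    unfolding hahn_weight_def rbinom_def e(1-4) X_def Y_def A_def e(6,7) Gamma_fact ..
  moreover have "Beta (real i + \<alpha> + 1) (real N - real i + \<alpha> + 1) = X * Y / G"
    unfolding Beta_def e(5) X_def Y_def G_def ..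
  ultimately show ?thesis
    using pos by (simp add: binomial_fact[OF assms(2)] power2_eq_square flip: G_def A_def)
qed

text \<open>
  Each grid value \<open>durrmeyer_eig * Q\<^sub>k(i)\<close>, multiplied by its weight, is up to a common constant the integral
  of \<open>R\<^sub>k w\<close> against the \<open>i\<close>-th Bernstein polynomial, and the sum over \<open>i\<close> can be taken under the integral.
\<close>

lemma hahn_inner_eq_bernstein:
  assumes \<alpha>: "\<alpha> \<ge> 0" and k: "k \<le> N"
  shows "durrmeyer_eig \<alpha> N k * hahn_inner \<alpha> N f (hahn_Q \<alpha> \<alpha> N k) =
     Gamma (real N + 2 * \<alpha> + 2) / (fact N * (Gamma (\<alpha> + 1))\<^sup>2) *
     integral {0..1} (\<lambda>t. (\<Sum>i\<le>N. f (real i) * Bernstein N i t) * (poly (jac \<alpha> k) t * sym_weight \<alpha> t))"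
proof -
  define \<kappa> where "\<kappa> = Gamma (real N + 2 * \<alpha> + 2) / (fact N * (Gamma (\<alpha> + 1))\<^sup>2)"
  define q where "q i = durrmeyer_eig \<alpha> N k * hahn_Q \<alpha> \<alpha> N k (real i) *
      Beta (real i + \<alpha> + 1) (real N - real i + \<alpha> + 1)" for i
  have "((\<lambda>t. \<Sum>i\<le>N. f (real i) * (Bernstein N i t * (poly (jac \<alpha> k) t * sym_weight \<alpha> t))) has_integral
      (\<Sum>i\<le>N. f (real i) * (real (N choose i) * q i))) {0..1}"
  proof (intro has_integral_sum has_integral_mult_right)
    fix i assume "i \<in> {..N}"
    then have i: "i \<le> N" by simp
    have "((\<lambda>s. real (N choose i) * (poly (jac \<alpha> k) s * beta_kernel (real i + \<alpha> + 1) (real N - real i + \<alpha> + 1) s))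
        has_integral real (N choose i) * q i) {0..1}"
      unfolding q_def using \<alpha> k i by (intro has_integral_mult_right has_integral_jac_beta_kernel) auto
    then show "((\<lambda>t. Bernstein N i t * (poly (jac \<alpha> k) t * sym_weight \<alpha> t)) has_integral real (N choose i) * q i) {0..1}"
    proof (rule has_integral_spike_finite[of "{0, 1}", rotated 2])
      fix t :: real assume "t \<in> {0..1} - {0, 1}"
      then have t: "0 < t" "t < 1" by auto
      have "beta_kernel (real i + \<alpha> + 1) (real N - real i + \<alpha> + 1) t = t ^ i * (1 - t) ^ (N - i) * sym_weight \<alpha> t"
      proof -
        have "t powr (real i + \<alpha>) = t ^ i * t powr \<alpha>"
          using t by (simp add: powr_add powr_realpow)
        moreover have "(1 - t) powr (real N - real i + \<alpha>) = (1 - t) ^ (N - i) * (1 - t) powr \<alpha>"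
        proof -
          have "(1 - t) powr (real (N - i) + \<alpha>) = (1 - t) ^ (N - i) * (1 - t) powr \<alpha>"
            using t by (simp add: powr_add powr_realpow del: of_nat_diff)
          then show ?thesis using i by (simp add: of_nat_diff)
        qed
        ultimately show ?thesis
          using t by (simp add: beta_kernel_def sym_weight_def)
      qed
      then show "Bernstein N i t * (poly (jac \<alpha> k) t * sym_weight \<alpha> t) =
        real (N choose i) * (poly (jac \<alpha> k) t * beta_kernel (real i + \<alpha> + 1) (real N - real i + \<alpha> + 1) t)"
        by (simp add: Bernstein_def)
    qed simp
  qed simp
  then have "((\<lambda>t. (\<Sum>i\<le>N. f (real i) * Bernstein N i t) * (poly (jac \<alpha> k) t * sym_weight \<alpha> t)) has_integral
      (\<Sum>i\<le>N. f (real i) * (real (N choose i) * q i))) {0..1}"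
    by (simp add: sum_distrib_right mult.assoc)
  then have "\<kappa> * integral {0..1} (\<lambda>t. (\<Sum>i\<le>N. f (real i) * Bernstein N i t) * (poly (jac \<alpha> k) t * sym_weight \<alpha> t))
     = \<kappa> * (\<Sum>i\<le>N. f (real i) * (real (N choose i) * q i))"
    by (simp add: integral_unique)
  also have "\<dots> = durrmeyer_eig \<alpha> N k * hahn_inner \<alpha> N f (hahn_Q \<alpha> \<alpha> N k)"
    unfolding hahn_inner_def sum_distrib_left
  proof (intro sum.cong refl)
    fix i assume "i \<in> {..N}"
    then have "i \<le> N" by simp
    then show "\<kappa> * (f (real i) * (real (N choose i) * q i)) =
         durrmeyer_eig \<alpha> N k * (f (real i) * hahn_Q \<alpha> \<alpha> N k (real i) * hahn_weight \<alpha> N i)"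
      unfolding hahn_weight_eq_Beta[OF \<alpha> \<open>i \<le> N\<close>] q_def \<kappa>_def by (simp only: mult_ac)
  qed
  finally show ?thesis by (simp add: \<kappa>_def)
qed

text \<open>
  The same factor turns numerator and denominator of the Hahn coefficient into integrals; in the
  denominator \<open>B Q\<^sub>k = R\<^sub>k\<close> produces the norm of the Jacobi polynomial.
\<close>

lemma hahn_partial_sum_eq:
  assumes \<alpha>: "\<alpha> \<ge> 0" and n: "n \<le> N"
  shows "hahn_partial_sum \<alpha> N n u (2 * t - 1) =
    (\<Sum>k\<le>n. jac_coeff \<alpha> (bernstein_op N (\<lambda>t. u (2 * t - 1))) k * hahn_Q \<alpha> \<alpha> N k (real N * t))"
  unfolding hahn_partial_sum_def
proof (intro sum.cong refl)
  fix k assume "k \<in> {..n}"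
  then have k: "k \<le> N" using n by simp
  define \<kappa> where "\<kappa> = Gamma (real N + 2 * \<alpha> + 2) / (fact N * (Gamma (\<alpha> + 1))\<^sup>2)"
  define \<mu> where "\<mu> = durrmeyer_eig \<alpha> N k"
  have "Gamma (real N + 2 * \<alpha> + 2) > 0" "Gamma (\<alpha> + 1) > 0" using \<alpha> by auto
  then have \<kappa>: "\<kappa> > 0" by (simp add: \<kappa>_def)
  have \<mu>: "\<mu> > 0" unfolding \<mu>_def by (rule durrmeyer_eig_bounds[OF \<alpha> k])
  define I where "I = integral {0..1} (\<lambda>t. bernstein_op N (\<lambda>t. u (2 * t - 1)) t * (poly (jac \<alpha> k) t * sym_weight \<alpha> t))"
  have "\<mu> * hahn_inner \<alpha> N (on_grid N u) (hahn_Q \<alpha> \<alpha> N k) = \<kappa> * I"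
    unfolding \<mu>_def \<kappa>_def I_def hahn_inner_eq_bernstein[OF \<alpha> k] by (simp add: on_grid_def bernstein_op_def)
  moreover have "\<mu> * hahn_inner \<alpha> N (hahn_Q \<alpha> \<alpha> N k) (hahn_Q \<alpha> \<alpha> N k) = \<kappa> * jac_norm \<alpha> k"
    unfolding \<mu>_def \<kappa>_def hahn_inner_eq_bernstein[OF \<alpha> k] Bernstein_hahn_Q[OF k]
    by (simp add: jac_norm_def power2_eq_square mult.assoc)
  ultimately have "hahn_inner \<alpha> N (on_grid N u) (hahn_Q \<alpha> \<alpha> N k) / hahn_inner \<alpha> N (hahn_Q \<alpha> \<alpha> N k) (hahn_Q \<alpha> \<alpha> N k)
      = I / jac_norm \<alpha> k"
    using \<mu> \<kappa> by (metis mult_divide_mult_cancel_left less_irrefl)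
  then show "hahn_inner \<alpha> N (on_grid N u) (hahn_Q \<alpha> \<alpha> N k) / hahn_inner \<alpha> N (hahn_Q \<alpha> \<alpha> N k) (hahn_Q \<alpha> \<alpha> N k)
      * hahn_Q \<alpha> \<alpha> N k (real N / 2 * (1 + (2 * t - 1)))
    = jac_coeff \<alpha> (bernstein_op N (\<lambda>t. u (2 * t - 1))) k * hahn_Q \<alpha> \<alpha> N k (real N * t)"
    by (simp add: jac_coeff_def I_def)
qed

text \<open>
  Only \<open>sqrt (jeig \<alpha> k)\<close>, of order \<open>k\<close>, appears: differentiating \<open>R\<^sub>k w\<close> and multiplying by \<open>t (1 - t)\<close> leaves
  \<open>t (1 - t) \<bar>R\<^sub>k'\<bar> w\<close> and a bounded term.  One square root of \<open>t (1 - t)\<close> goes into Bernstein's inequality for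
  \<open>R\<^sub>k'\<close>, the other is at most \<open>1\<close>.
\<close>

lemma jac_coeff_bernstein_error:
  assumes \<alpha>: "\<alpha> \<ge> 0" and N: "N \<ge> 1" and v: "continuous_on {0..1} v"
    and V: "\<And>m t. mono_on {..m} t \<Longrightarrow> t ` {..m} \<subseteq> {0..1} \<Longrightarrow> (\<Sum>i<m. \<bar>v (t (Suc i)) - v (t i)\<bar>) \<le> V"
  shows "\<bar>jac_coeff \<alpha> (bernstein_op N v) k - jac_coeff \<alpha> v k\<bar>
           \<le> V * (sqrt (jeig \<alpha> k) + \<alpha> + 2) / real N * (1 / jac_norm \<alpha> k)"
proof -
  define R where "R = poly (jac \<alpha> k)"
  define R' where "R' = poly (pderiv (jac \<alpha> k))"
  define g where "g t = R t * sym_weight \<alpha> t" for t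
  define g' where "g' t = R' t * sym_weight \<alpha> t + \<alpha> * (1 - 2 * t) * sym_weight \<alpha> t / (t * (1 - t)) * R t" for t
  have R1: "\<bar>R s\<bar> \<le> 1" if "0 \<le> s" "s \<le> 1" for s
    unfolding R_def by (rule abs_jac_le_1[OF \<alpha> that])
  have "\<bar>integral {0..1} (\<lambda>t. bernstein_op N v t * g t) - integral {0..1} (\<lambda>t. v t * g t)\<bar>
      \<le> V * ((sqrt (jeig \<alpha> k) + \<alpha>) + 2 * 1) / real N"
  proof (rule bernstein_functional_error[where g' = g', OF N v V])
    show "continuous_on {0..1} g"
      unfolding g_def R_def by (intro continuous_intros continuous_on_sym_weight \<alpha>)
  next
    fix s :: real assume s: "0 < s" "s < 1"
    show "(g has_real_derivative g' s) (at s)"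
      unfolding g_def g'_def R_def R'_def by (intro DERIV_mult poly_DERIV DERIV_sym_weight s)
    have w: "0 \<le> sym_weight \<alpha> s" "sym_weight \<alpha> s \<le> 1"
      using s by (auto intro: sym_weight_nonneg sym_weight_le_1[OF \<alpha>])
    have p: "0 \<le> s * (1 - s)" "s * (1 - s) \<le> 1" using s by (auto intro: mult_le_one)
    have "s * (1 - s) * \<bar>g' s\<bar> = \<bar>s * (1 - s) * g' s\<bar>" using s by (simp add: abs_mult)
    also have "s * (1 - s) * g' s = s * (1 - s) * R' s * sym_weight \<alpha> s + \<alpha> * ((1 - 2 * s) * sym_weight \<alpha> s * R s)"
      using s by (simp add: g'_def distrib_left)
    also have "\<bar>\<dots>\<bar> \<le> \<bar>s * (1 - s) * R' s * sym_weight \<alpha> s\<bar> + \<bar>\<alpha> * ((1 - 2 * s) * sym_weight \<alpha> s * R s)\<bar>"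
      by (rule abs_triangle_ineq)
    also have "\<bar>s * (1 - s) * R' s * sym_weight \<alpha> s\<bar> \<le> sqrt (jeig \<alpha> k)"
    proof -
      have "sqrt (s * (1 - s)) * sqrt (s * (1 - s)) = s * (1 - s)" using p by simp
      then have "\<bar>s * (1 - s) * R' s * sym_weight \<alpha> s\<bar>
        = (sqrt (s * (1 - s)) * sym_weight \<alpha> s) * (sqrt (s * (1 - s)) * \<bar>R' s\<bar>)"
        using w p by (simp add: abs_mult mult_ac)
      also have "\<dots> \<le> 1 * sqrt (jeig \<alpha> k)"
      proof (rule mult_mono)
        show "sqrt (s * (1 - s)) * sym_weight \<alpha> s \<le> 1" using w p by (intro mult_le_one) auto
        show "sqrt (s * (1 - s)) * \<bar>R' s\<bar> \<le> sqrt (jeig \<alpha> k)"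
          unfolding R'_def using s by (intro jac_bernstein_inequality \<alpha>) auto
      qed (use p in auto)
      finally show ?thesis by simp
    qed
    also have "\<bar>\<alpha> * ((1 - 2 * s) * sym_weight \<alpha> s * R s)\<bar> \<le> \<alpha> * 1"
      unfolding abs_mult[of \<alpha>]
    proof (rule mult_mono)
      show "\<bar>(1 - 2 * s) * sym_weight \<alpha> s * R s\<bar> \<le> 1"
        unfolding abs_mult using w R1[of s] s by (intro mult_le_one) auto
    qed (use \<alpha> in auto)
    finally show "s * (1 - s) * \<bar>g' s\<bar> \<le> sqrt (jeig \<alpha> k) + \<alpha>" by simp
  next
    fix s :: real assume s: "0 \<le> s" "s \<le> 1"
    show "\<bar>g s\<bar> \<le> 1"
      unfolding g_def abs_mult
      using s R1[of s] sym_weight_nonneg[of \<alpha> s] sym_weight_le_1[OF \<alpha>, of s]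
      by (intro mult_le_one) auto
  qed
  moreover have "jac_norm \<alpha> k > 0" by (rule jac_norm_pos[OF \<alpha>])
  ultimately have "\<bar>integral {0..1} (\<lambda>t. bernstein_op N v t * g t) - integral {0..1} (\<lambda>t. v t * g t)\<bar> / jac_norm \<alpha> k
      \<le> V * ((sqrt (jeig \<alpha> k) + \<alpha>) + 2 * 1) / real N / jac_norm \<alpha> k"
    by (intro divide_right_mono) auto
  then show ?thesis
    using \<open>jac_norm \<alpha> k > 0\<close>
    by (simp add: jac_coeff_def g_def R_def abs_divide add.assoc flip: diff_divide_distrib)
qed

lemma abs_jac_coeff_le:
  assumes \<alpha>: "\<alpha> \<ge> 0" and f: "continuous_on {0..1} f" and U: "\<And>t. 0 \<le> t \<Longrightarrow> t \<le> 1 \<Longrightarrow> \<bar>f t\<bar> \<le> U"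
  shows "\<bar>jac_coeff \<alpha> f k\<bar> \<le> U * sqrt (1 / jac_norm \<alpha> k)"
proof -
  define h where "h = jac_norm \<alpha> k"
  define R where "R = poly (jac \<alpha> k)"
  define w where "w = sym_weight \<alpha>"
  have h: "h > 0" unfolding h_def by (rule jac_norm_pos[OF \<alpha>])
  have U0: "U \<ge> 0" using U[of 0] by simp
  have cw: "continuous_on {0..1} w" unfolding w_def by (rule continuous_on_sym_weight[OF \<alpha>])
  have w: "0 \<le> w t" "0 \<le> t \<Longrightarrow> t \<le> 1 \<Longrightarrow> w t \<le> 1" for t
    using sym_weight_nonneg sym_weight_le_1[OF \<alpha>] by (auto simp: w_def)
  define I where "I = integral {0..1} (\<lambda>t. f t * (R t * w t))"
  have I: "((\<lambda>t. f t * (R t * w t)) has_integral I) {0..1}"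
    unfolding I_def R_def by (intro integrable_integral integrable_continuous_real continuous_intros f cw)
  have "((\<lambda>t. (R t)\<^sup>2 * w t) has_integral h) {0..1}"
    unfolding R_def w_def h_def by (rule has_integral_jac_norm[OF \<alpha>])
  then have J: "((\<lambda>t. U / 2 * (sqrt h * 1 + (R t)\<^sup>2 * w t / sqrt h)) has_integral U / 2 * (sqrt h * 1 + h / sqrt h)) {0..1}"
    using has_integral_const_real[of "1::real" 0 1]
    by (intro has_integral_mult_right has_integral_add has_integral_divide) auto
  have le: "\<bar>f t * (R t * w t)\<bar> \<le> U / 2 * (sqrt h * 1 + (R t)\<^sup>2 * w t / sqrt h)" if "t \<in> {0..1}" for t
  proof -
    \<comment> \<open>Integrating this pointwise inequality replaces the Cauchy-Schwarz inequality.\<close>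
    have "0 \<le> (sqrt h - \<bar>R t\<bar>)\<^sup>2" by simp
    then have "2 * (\<bar>R t\<bar> * sqrt h) \<le> h + (R t)\<^sup>2" using h by (simp add: power2_diff mult_ac)
    then have "\<bar>R t\<bar> \<le> (h + (R t)\<^sup>2) / (2 * sqrt h)" using h by (simp add: pos_le_divide_eq)
    also have "\<dots> = (sqrt h + (R t)\<^sup>2 / sqrt h) / 2"
      using h by (simp add: field_simps flip: power2_eq_square)
    finally have "\<bar>R t\<bar> * w t \<le> (sqrt h + (R t)\<^sup>2 / sqrt h) / 2 * w t"
      using w by (intro mult_right_mono) auto
    also have "\<dots> = (sqrt h * w t + (R t)\<^sup>2 * w t / sqrt h) / 2" by (simp add: algebra_simps)
    also have "\<dots> \<le> (sqrt h * 1 + (R t)\<^sup>2 * w t / sqrt h) / 2"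
      using h w that by (intro divide_right_mono add_right_mono mult_left_mono) auto
    finally have "\<bar>f t\<bar> * (\<bar>R t\<bar> * w t) \<le> U * ((sqrt h * 1 + (R t)\<^sup>2 * w t / sqrt h) / 2)"
      using U[of t] that U0 w by (intro mult_mono) auto
    then show ?thesis using w by (simp add: abs_mult)
  qed
  have eq: "U / 2 * (sqrt h * 1 + h / sqrt h) = U * sqrt h"
    using h by (simp add: real_div_sqrt)
  have "I \<le> U * sqrt h" unfolding eq[symmetric] by (rule has_integral_le[OF I J]) (use le in force)
  moreover have "- I \<le> U * sqrt h" unfolding eq[symmetric]
    by (rule has_integral_le[OF has_integral_neg[OF I] J]) (use le in force)
  ultimately have "\<bar>I\<bar> / h \<le> U * sqrt h / h" using h by (intro divide_right_mono) auto
  also have "\<dots> = U * sqrt (1 / h)" using h by (simp add: real_sqrt_divide field_simps)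
  finally show ?thesis using h by (simp add: jac_coeff_def I_def R_def w_def h_def abs_divide)
qed

lemma abs_bernstein_op_le:
  assumes U: "\<And>t. 0 \<le> t \<Longrightarrow> t \<le> 1 \<Longrightarrow> \<bar>v t\<bar> \<le> U" and t: "0 \<le> t" "t \<le> 1"
  shows "\<bar>bernstein_op N v t\<bar> \<le> U"
proof -
  have "\<bar>bernstein_op N v t\<bar> \<le> (\<Sum>i\<le>N. \<bar>v (real i / real N)\<bar> * Bernstein N i t)"
    unfolding bernstein_op_def
    by (rule order_trans[OF sum_abs]) (simp add: abs_mult Bernstein_nonneg t)
  also have "\<dots> \<le> (\<Sum>i\<le>N. U * Bernstein N i t)"
    by (intro sum_mono mult_right_mono U Bernstein_nonneg t) (auto intro: divide_le_eq_1[THEN iffD2])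
  also have "\<dots> = U" by (simp flip: sum_distrib_left)
  finally show ?thesis .
qed

theorem theorem1p1:
  fixes \<alpha> :: real and u :: "real \<Rightarrow> real"
  assumes "\<alpha> \<ge> 0"
    and "continuous_on {-1..1} u"
    and "bounded_variation_on (-1) 1 u"
  shows "\<exists>C>0. \<forall>N n :: nat. \<forall>x\<in>{-1..1}.
           N \<ge> 1 \<longrightarrow> n \<ge> 1 \<longrightarrow> real n \<le> n_bound \<alpha> N \<longrightarrow>
           \<bar>u x - hahn_partial_sum \<alpha> N n u x\<bar>
             \<le> \<bar>u x - jacobi_partial_sum \<alpha> n u x\<bar>
               + C * (real n powr (3 + \<alpha> + max 1 \<alpha>) / real N)"
proof -
  note \<alpha> = assms(1)
  define v where "v = (\<lambda>t. u (2 * t - 1))"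
  have v: "continuous_on {0..1} v"
    unfolding v_def by (rule continuous_on_compose2[OF assms(2)]) (auto intro!: continuous_intros)
  obtain U where U: "U \<ge> 0" "\<And>t. 0 \<le> t \<Longrightarrow> t \<le> 1 \<Longrightarrow> \<bar>v t\<bar> \<le> U"
  proof -
    have "bounded (v ` {0..1})" by (intro compact_imp_bounded compact_continuous_image v) auto
    then obtain B where "\<forall>y\<in>v ` {0..1}. norm y \<le> B" unfolding bounded_iff by blast
    then have B: "\<And>t. t \<in> {0..1} \<Longrightarrow> \<bar>v t\<bar> \<le> B" by simp
    show ?thesis by (rule that[of B]) (use B order_trans[OF abs_ge_zero B[of 0]] in auto)
  qed
  obtain V where V: "\<And>m t. mono_on {..m} t \<Longrightarrow> t ` {..m} \<subseteq> {0..1} \<Longrightarrow>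
       (\<Sum>i<m. \<bar>v (t (Suc i)) - v (t i)\<bar>) \<le> V"
  proof -
    obtain V where V: "\<And>m t. mono_on {..m} t \<Longrightarrow> t ` {..m} \<subseteq> {-1..1} \<Longrightarrow>
       (\<Sum>i<m. \<bar>u (t (Suc i)) - u (t i)\<bar>) \<le> V"
      using assms(3) unfolding bounded_variation_on_def bdd_above_def by blast
    show ?thesis
    proof (rule that[of V])
      fix m :: nat and t :: "nat \<Rightarrow> real" assume t: "mono_on {..m} t" "t ` {..m} \<subseteq> {0..1}"
      have "mono_on {..m} (\<lambda>i. 2 * t i - 1)" using t(1) by (simp add: mono_on_def)
      moreover have "(\<lambda>i. 2 * t i - 1) ` {..m} \<subseteq> {-1..1}" using t(2) by (auto simp: image_subset_iff)
      ultimately show "(\<Sum>i<m. \<bar>v (t (Suc i)) - v (t i)\<bar>) \<le> V"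
        unfolding v_def by (rule V)
    qed
  qed
  have V0: "V \<ge> 0" using V[of 0 "\<lambda>_. 0"] by (simp add: mono_on_def)
  obtain C1 where C1: "C1 > 0" "\<And>k. k \<ge> 1 \<Longrightarrow> 1 / jac_norm \<alpha> k \<le> C1 * real k powr (2 * \<alpha> + 1)"
    using inverse_jac_norm_le[OF \<alpha>] by blast
  define E where "E = 4 * exp (6 * \<alpha> + 8)"
  have E: "E \<ge> 0" by (simp add: E_def)
  define p where "p = 2 + \<alpha> + max 1 \<alpha>"
  define D where "D = V * (3 * \<alpha> + 4) * C1 + U * sqrt C1 * E * (2 * \<alpha> + 2)"
  \<comment> \<open>For \<open>k = 0\<close> the power \<open>real k powr p\<close> is \<open>0\<close>, so this term needs a constant of its own.\<close>
  define D0 where "D0 = V * (\<alpha> + 2) * (1 / jac_norm \<alpha> 0)"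
  have D: "D \<ge> 0" "D0 \<ge> 0"
    unfolding D_def D0_def using \<alpha> V0 U(1) C1(1) E jac_norm_pos[OF \<alpha>, of 0]
    by (auto intro!: add_nonneg_nonneg mult_nonneg_nonneg)
  have term_bound: "\<bar>jac_coeff \<alpha> (bernstein_op N v) k * hahn_Q \<alpha> \<alpha> N k (real N * t) - jac_coeff \<alpha> v k * poly (jac \<alpha> k) t\<bar>
      \<le> (if k = 0 then D0 else D * real k powr p) / real N"
    if N: "N \<ge> 1" and k: "real k \<le> n_bound \<alpha> N" and t: "0 \<le> t" "t \<le> 1" for N k t
  proof -
    define a where "a = jac_coeff \<alpha> (bernstein_op N v) k"
    define b where "b = jac_coeff \<alpha> v k"
    define Q where "Q = hahn_Q \<alpha> \<alpha> N k (real N * t)"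
    define R where "R = poly (jac \<alpha> k) t"
    have N0: "real N > 0" using N by simp
    have cB: "continuous_on {0..1} (bernstein_op N v)"
      unfolding bernstein_op_def[abs_def] Bernstein_def by (intro continuous_intros)
    have ab: "\<bar>a - b\<bar> \<le> V * (sqrt (jeig \<alpha> k) + \<alpha> + 2) / real N * (1 / jac_norm \<alpha> k)"
      unfolding a_def b_def by (rule jac_coeff_bernstein_error[OF \<alpha> N v V])
    have a: "\<bar>a\<bar> \<le> U * sqrt (1 / jac_norm \<alpha> k)"
      unfolding a_def by (rule abs_jac_coeff_le[OF \<alpha> cB abs_bernstein_op_le[OF U(2)]])
    have QR: "\<bar>Q - R\<bar> \<le> E * jeig \<alpha> k / real N"
      unfolding Q_def R_def E_def by (rule hahn_Q_jac_distance[OF \<alpha> N k t])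
    have R: "\<bar>R\<bar> \<le> 1" unfolding R_def by (rule abs_jac_le_1[OF \<alpha> t])
    \<comment> \<open>One error in the coefficients, measured against \<open>\<bar>R\<bar> \<le> 1\<close>, and one in the polynomials.\<close>
    have "a * Q - b * R = (a - b) * R + a * (Q - R)" by (simp add: algebra_simps)
    then have "\<bar>a * Q - b * R\<bar> \<le> \<bar>a - b\<bar> * \<bar>R\<bar> + \<bar>a\<bar> * \<bar>Q - R\<bar>"
      by (metis abs_mult abs_triangle_ineq)
    also have "\<dots> \<le> \<bar>a - b\<bar> * 1 + (U * sqrt (1 / jac_norm \<alpha> k)) * (E * jeig \<alpha> k / real N)"
      using R a QR by (intro add_mono mult_mono) auto
    also have "\<dots> \<le> V * (sqrt (jeig \<alpha> k) + \<alpha> + 2) / real N * (1 / jac_norm \<alpha> k)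
        + (U * sqrt (1 / jac_norm \<alpha> k)) * (E * jeig \<alpha> k / real N)"
      using ab by simp
    also have "\<dots> = (V * (sqrt (jeig \<alpha> k) + \<alpha> + 2) * (1 / jac_norm \<alpha> k)
        + (U * sqrt (1 / jac_norm \<alpha> k)) * (E * jeig \<alpha> k)) / real N"
      by (simp add: add_divide_distrib)
    also have "\<dots> \<le> (if k = 0 then D0 else D * real k powr p) / real N"
    proof (cases "k = 0")
      case True
      then show ?thesis by (simp add: jeig_def D0_def)
    next
      case False
      then have k1: "real k \<ge> 1" and kn: "k \<ge> 1" by simp_all
      have "real k * (real k + 2 * \<alpha> + 1) \<le> real k * ((2 * \<alpha> + 2) * real k)"
        using k1 \<alpha> mult_left_mono[OF k1, of "2 * \<alpha> + 1"]
        by (intro mult_left_mono) (auto simp: algebra_simps)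
      then have lam: "jeig \<alpha> k \<le> (2 * \<alpha> + 2) * (real k)\<^sup>2"
        by (simp add: jeig_def power2_eq_square mult_ac)
      also have "\<dots> \<le> ((2 * \<alpha> + 2) * real k)\<^sup>2"
        using \<alpha> by (simp add: power_mult_distrib) (intro mult_right_mono; simp add: power2_eq_square)
      finally have "sqrt (jeig \<alpha> k) \<le> (2 * \<alpha> + 2) * real k"
        using \<alpha> by (intro real_le_lsqrt) auto
      moreover have "\<alpha> + 2 \<le> (\<alpha> + 2) * real k"
        using mult_left_mono[OF k1, of "\<alpha> + 2"] \<alpha> by simp
      ultimately have s: "sqrt (jeig \<alpha> k) + \<alpha> + 2 \<le> (3 * \<alpha> + 4) * real k"
        by (simp add: algebra_simps)
      note C = C1(2)[OF kn]
      have h: "1 / jac_norm \<alpha> k > 0" using jac_norm_pos[OF \<alpha>] by simp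
      have "sqrt (1 / jac_norm \<alpha> k) \<le> sqrt (C1 * real k powr (2 * \<alpha> + 1))"
        using C by (rule real_sqrt_le_mono)
      also have "\<dots> = sqrt C1 * real k powr (\<alpha> + 1 / 2)"
        using k1 by (simp add: real_sqrt_mult powr_half_sqrt[symmetric] powr_powr algebra_simps)
      finally have sC: "sqrt (1 / jac_norm \<alpha> k) \<le> sqrt C1 * real k powr (\<alpha> + 1 / 2)" .
      have "V * (sqrt (jeig \<alpha> k) + \<alpha> + 2) * (1 / jac_norm \<alpha> k)
          \<le> V * ((3 * \<alpha> + 4) * real k) * (C1 * real k powr (2 * \<alpha> + 1))"
        using s C h V0 \<alpha> by (intro mult_mono mult_left_mono) auto
      also have "\<dots> = V * (3 * \<alpha> + 4) * C1 * (real k powr 1 * real k powr (2 * \<alpha> + 1))"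
        using k1 by simp
      \<comment> \<open>The exponent \<open>2 \<alpha> + 2\<close> is at most \<open>p\<close>, with equality for \<open>\<alpha> \<ge> 1\<close>.\<close>
      also have "\<dots> \<le> V * (3 * \<alpha> + 4) * C1 * real k powr p"
        unfolding powr_add[symmetric]
        using k1 V0 \<alpha> C1(1) by (intro mult_left_mono powr_mono) (auto simp: p_def)
      finally have first: "V * (sqrt (jeig \<alpha> k) + \<alpha> + 2) * (1 / jac_norm \<alpha> k) \<le> V * (3 * \<alpha> + 4) * C1 * real k powr p" .
      have "(U * sqrt (1 / jac_norm \<alpha> k)) * (E * jeig \<alpha> k)
          \<le> (U * (sqrt C1 * real k powr (\<alpha> + 1 / 2))) * (E * ((2 * \<alpha> + 2) * (real k)\<^sup>2))"
        using sC lam U(1) E h C1(1) \<alpha> jeig_nonneg[OF \<alpha>, of k]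
        by (intro mult_mono mult_left_mono) auto
      also have "\<dots> = U * sqrt C1 * E * (2 * \<alpha> + 2) * (real k powr (\<alpha> + 1 / 2) * real k powr 2)"
        using k1 by simp
      \<comment> \<open>The exponent \<open>\<alpha> + 5/2\<close> is at most \<open>3 + \<alpha> \<le> p\<close>.\<close>
      also have "\<dots> \<le> U * sqrt C1 * E * (2 * \<alpha> + 2) * real k powr p"
        unfolding powr_add[symmetric]
        using k1 U(1) E \<alpha> C1(1) by (intro mult_left_mono powr_mono) (auto simp: p_def)
      finally have "(U * sqrt (1 / jac_norm \<alpha> k)) * (E * jeig \<alpha> k) \<le> U * sqrt C1 * E * (2 * \<alpha> + 2) * real k powr p" .
      with first have "V * (sqrt (jeig \<alpha> k) + \<alpha> + 2) * (1 / jac_norm \<alpha> k) + (U * sqrt (1 / jac_norm \<alpha> k)) * (E * jeig \<alpha> k)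
          \<le> D * real k powr p"
        by (simp add: D_def distrib_right)
      then show ?thesis using False by (simp add: divide_right_mono)
    qed
    finally show ?thesis by (simp add: a_def b_def Q_def R_def)
  qed
  show ?thesis
  proof (intro exI[of _ "D0 + D + 1"] conjI allI ballI impI)
    show "D0 + D + 1 > 0" using D by linarith
  next
    fix N n :: nat and x :: real
    assume x: "x \<in> {-1..1}" and N: "N \<ge> 1" and n: "n \<ge> 1" and nb: "real n \<le> n_bound \<alpha> N"
    define t where "t = (x + 1) / 2"
    have t: "0 \<le> t" "t \<le> 1" "x = 2 * t - 1" using x by (auto simp: t_def field_simps)
    have n1: "real n \<ge> 1" using n by simp
    have p0: "p \<ge> 0" using \<alpha> by (simp add: p_def)
    have "n \<le> N" by (rule n_bound_consequences[OF \<alpha> N nb])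
    then have "hahn_partial_sum \<alpha> N n u x - jacobi_partial_sum \<alpha> n u x =
      (\<Sum>k\<le>n. jac_coeff \<alpha> (bernstein_op N v) k * hahn_Q \<alpha> \<alpha> N k (real N * t) - jac_coeff \<alpha> v k * poly (jac \<alpha> k) t)"
      unfolding t(3) using hahn_partial_sum_eq[OF \<alpha>, of n N u t] jacobi_partial_sum_eq[OF \<alpha> v[unfolded v_def], of n t]
      by (simp add: v_def sum_subtractf)
    then have "\<bar>hahn_partial_sum \<alpha> N n u x - jacobi_partial_sum \<alpha> n u x\<bar> \<le>
      (\<Sum>k\<le>n. \<bar>jac_coeff \<alpha> (bernstein_op N v) k * hahn_Q \<alpha> \<alpha> N k (real N * t) - jac_coeff \<alpha> v k * poly (jac \<alpha> k) t\<bar>)"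
      by (simp only: sum_abs)
    also have "\<dots> \<le> (\<Sum>k\<le>n. (if k = 0 then D0 else D * real k powr p) / real N)"
      using nb t by (intro sum_mono term_bound N) auto
    also have "\<dots> \<le> (\<Sum>k\<le>n. (if k = 0 then D0 else 0) / real N + (if k = 0 then 0 else D * real n powr p / real N))"
      using p0 D by (intro sum_mono) (auto intro!: divide_right_mono mult_left_mono powr_mono2)
    also have "\<dots> = D0 / real N + real n * (D * real n powr p / real N)"
    proof -
      have "{..n} - {0} = {1..n}" by auto
      then have "(\<Sum>k\<le>n. if k = 0 then 0 else D * real n powr p / real N) = (\<Sum>k\<in>{1..n}. D * real n powr p / real N)"
        by (intro sum.mono_neutral_cong_right) auto
      then show ?thesis by (simp add: sum.distrib if_distrib[of "\<lambda>y. y / real N"] cong: if_cong)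
    qed
    also have "\<dots> = (D0 + D * real n powr (p + 1)) / real N"
      using n1 by (simp add: powr_add add_divide_distrib)
    also have "\<dots> \<le> ((D0 + D + 1) * real n powr (p + 1)) / real N"
    proof (rule divide_right_mono)
      have "1 \<le> real n powr (p + 1)" using n1 p0 by (intro ge_one_powr_ge_zero) auto
      then show "D0 + D * real n powr (p + 1) \<le> (D0 + D + 1) * real n powr (p + 1)"
        using D mult_left_mono[of 1 "real n powr (p + 1)" "D0 + 1"] by (simp add: algebra_simps)
    qed simp
    also have "p + 1 = 3 + \<alpha> + max 1 \<alpha>" by (simp add: p_def)
    finally have "\<bar>hahn_partial_sum \<alpha> N n u x - jacobi_partial_sum \<alpha> n u x\<bar>
       \<le> (D0 + D + 1) * (real n powr (3 + \<alpha> + max 1 \<alpha>) / real N)" by simp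
    then show "\<bar>u x - hahn_partial_sum \<alpha> N n u x\<bar>
             \<le> \<bar>u x - jacobi_partial_sum \<alpha> n u x\<bar>
               + (D0 + D + 1) * (real n powr (3 + \<alpha> + max 1 \<alpha>) / real N)"
      by linarith
  qed
qed

end
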